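(* Let $r_1, r_2, d \in \mathbb{N}$ satisfy $r_1 \geq d \geq 2$ and let $A, B$ be finite, non-empty subsets of $\mathbb{R}^d$ such that $|A| \geq |B|$ and $\dim(A+B) = d$. Let $v \in \mathbb{R}^d \setminus \{0\}$ satisfy $|\pi_v(A)| = r_1$ and $|\pi_v(B)| = r_2$. Then \[ |A+B| \geq |A| + \left(d + 1 - \frac{1}{r_1 - d + 2} - \frac{1}{r_2 - c + 2}\right)|B| - (d-1)(r_1 + r_2), \] where $c = d$ if $r_2 \geq d$, and $c = \dim(B)$ if $r_2 < d$.
   Context: For finite sets $A, B \subseteq \mathbb{R}^d$, $A + B = \{a+b : a \in A,\ b \in B\}$. For a non-empty set $A \subseteq \mathbb{R}^d$, $\dim(A)$ denotes the dimension of the affine subspace spanned by $A$. For $v \in \mathbb{R}^d \setminus \{0\}$, $H_v$ is the hyperplane through the origin orthogonal to $v$ and $\pi_v : \mathbb{R}^d \to H_v$ is the orthogonal projection. $\mathbb{N}$ denotes the positive integers. *)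

theory Defs
  imports "HOL-Analysis.Analysis"
begin

definition orth_hyperplane :: "'a::real_inner \<Rightarrow> 'a set" where
  "orth_hyperplane v = {x. v \<bullet> x = 0}"

(* Meaningful for v \<noteq> 0 only. *)
definition orth_proj :: "'a::real_inner \<Rightarrow> 'a \<Rightarrow> 'a" where
  "orth_proj v x = x - ((v \<bullet> x) / (v \<bullet> v)) *\<^sub>R v"

lemma orth_proj_iff:
  assumes "v \<noteq> 0"
  shows "orth_proj v x = y \<longleftrightarrow>
    y \<in> orth_hyperplane v \<and> (\<forall>z\<in>orth_hyperplane v. orthogonal (x - y) z)"
proof -
  let ?p = "orth_proj v x"
  have p: "?p \<in> orth_hyperplane v"
    using assms by (simp add: orth_hyperplane_def orth_proj_def inner_diff_right)
  have o: "orthogonal (x - ?p) z" if "z \<in> orth_hyperplane v" for z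
    using that by (simp add: orth_hyperplane_def orth_proj_def orthogonal_def)
  have "?p = y"
    if y: "y \<in> orth_hyperplane v" and oy: "\<forall>z\<in>orth_hyperplane v. orthogonal (x - y) z"
  proof -
    have "?p - y \<in> orth_hyperplane v"
      using p y by (simp add: orth_hyperplane_def inner_diff_right)
    then have "(x - y) \<bullet> (?p - y) = 0" "(x - ?p) \<bullet> (?p - y) = 0"
      using o oy by (auto simp: orthogonal_def)
    then have "(?p - y) \<bullet> (?p - y) = 0"
      by (simp add: inner_diff_left)
    then show ?thesis by simp
  qed
  then show ?thesis using p o by blast
qed

end

theory Submission
  imports Defs
begin

text \<open>
  Compressing $A$ and $B$ simultaneously along a direction $w$ (pushing every fibre down to
  heights $0, 1, 2, \dots$) keeps the cardinalities, does not enlarge $A + B$, and does not raise the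
  dimension of $B$. Compressing first along $v$ and then only along directions transversal to $v$
  also keeps the numbers $r_1, r_2$ of lines. Since $A + B$ is full-dimensional, there is a basis
  consisting of $v$ and of differences of points of $A$ or of $B$; in these coordinates
  compression leads to down-closed subsets of $\mathbb{N}^d$ which together contain all unit vectors.

  If some $e_c \neq v$ lies in both sets, compress further along $e_k - m e_c$, where $m e_c$ is the
  last multiple of $e_c$ in $A$ (or in $B$) and $e_k$ lies in the same set. A pair that is stable
  under all these operations consists of combs: the lines of $A$ pass through
  $0, e_c, \dots, (L-1) e_c$ and through some $e_k$ with $k \in I$, and similarly $M$, $J$ for $B$.
  For the two-dimensional cores, averaging over lattice paths gives
  $(L + M - 1)(|A|/L + |B|/M - 1)$, and every further coordinate contributes another $|A|$, another
  $|B|$, or the mean of both. If no such $e_c$ exists, the supports of $A$ and $B$ are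
  complementary and the sums of distinct pairs of lines are distinct lines.
\<close>

section \<open>Compression along a direction\<close>

text \<open>The fractions come from the number of core lines. With \<open>L\<close>,
  \<open>M\<close>, \<open>I\<close>, \<open>J\<close> as above, r_1 = L + |I| and r_2 = M + |J|.
  The comb estimate is mu |A| + nu |B| - (d - 1)(r_1 + r_2), where mu + nu = (L + M - 1)(1/L + 1/M)
  + d - 2 is at least d + 2 - 1/L - 1/M, because M/L + L/M >= 2. As |A| >= |B| and mu >= 1, the
  excess mu - 1 can be charged to |B|. The error has d - 1 units of r_1 + r_2: one for the core and
  one for each further coordinate. It remains that L >= r_1 - d + 2, which holds since only d - 2
  directions are left for teeth, and that M >= r_2 - c + 2. For r_2 < d the latter is a statement on
  dimension: 0, e_c, the teeth and the image of v must all lie in the compressed B, which needs a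
  line parallel to v with two points of B. Without such a line, |A + B| >= |A| is already enough.
  Stable pairs exist because a compression that changes a pair lowers a weighted sum of coordinates;
  the weights make e_k heavier than every multiple m e_c that occurs.\<close>

lemma card_sumset_real:
  fixes P Q :: "real set"
  assumes "finite P" "P \<noteq> {}" "finite Q" "Q \<noteq> {}"
  shows "card P + card Q \<le> card (P + Q) + 1"
proof -
  let ?P = "(\<lambda>x. x + Min Q) ` P" and ?Q = "(\<lambda>y. Max P + y) ` Q"
  \<comment> \<open>\<open>Max P + Min Q\<close> is the largest element of the first translate and
    the smallest of the second.\<close>
  have "?P \<inter> ?Q \<subseteq> {Max P + Min Q}"
  proof
    fix z assume "z \<in> ?P \<inter> ?Q"
    then obtain x y where z: "x \<in> P" "y \<in> Q" "z = x + Min Q" "z = Max P + y" by blast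
    have "x \<le> Max P" "Min Q \<le> y" using z assms by auto
    then show "z \<in> {Max P + Min Q}" using z by auto
  qed
  then have 1: "card (?P \<inter> ?Q) \<le> 1" using card_mono[of "{Max P + Min Q}"] by simp
  have "?P \<union> ?Q \<subseteq> P + Q"
    using Min_in[OF assms(3,4)] Max_in[OF assms(1,2)] by (auto simp: set_plus_def)
  then have 2: "card (?P \<union> ?Q) \<le> card (P + Q)"
    using assms by (intro card_mono finite_set_plus) auto
  have "card ?P = card P" "card ?Q = card Q"
    by (auto intro!: card_image inj_onI)
  then show ?thesis
    using card_Un_Int[of ?P ?Q] assms 1 2 by simp
qed

text \<open>The height is any linear functional with value 1 at \<open>w\<close>, not the orthogonal
  one: for w = e_k - m e_c it will be coordinate k, so that integer points have integer
  heights.\<close>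

locale compression =
  fixes w :: "'a::euclidean_space" and \<tau> :: "'a \<Rightarrow> real"
  assumes linear_height: "linear \<tau>" and height_w [simp]: "\<tau> w = 1"
begin

definition base :: "'a \<Rightarrow> 'a" where "base x = x - \<tau> x *\<^sub>R w"

definition fibre :: "'a set \<Rightarrow> 'a \<Rightarrow> 'a set" where "fibre A u = {x \<in> A. base x = u}"

definition rank :: "'a set \<Rightarrow> 'a \<Rightarrow> nat" where
  "rank A x = card {y \<in> A. base y = base x \<and> \<tau> y < \<tau> x}"

definition push :: "'a set \<Rightarrow> 'a \<Rightarrow> 'a" where
  "push A x = base x + real (rank A x) *\<^sub>R w"

definition compress :: "'a set \<Rightarrow> 'a set" where "compress A = push A ` A"

lemma height_simps [simp]: "\<tau> (x + y) = \<tau> x + \<tau> y" "\<tau> (x - y) = \<tau> x - \<tau> y"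
  "\<tau> (r *\<^sub>R x) = r * \<tau> x" "\<tau> 0 = 0"
  using linear_height by (simp_all add: linear_add linear_diff linear_scale linear_0)

lemma linear_base: "linear base"
  unfolding base_def by (rule linearI) (simp_all add: algebra_simps)

lemma base_simps [simp]: "base (x + y) = base x + base y" "base (x - y) = base x - base y"
  "base (r *\<^sub>R x) = r *\<^sub>R base x" "base w = 0" "base 0 = 0" "\<tau> (base x) = 0" "base (base x) = base x"
  by (simp_all add: base_def scaleR_diff_right scaleR_add_left scaleR_diff_left)

lemma base_eq_self: "\<tau> x = 0 \<Longrightarrow> base x = x" by (simp add: base_def)

lemma base_height: "base x + \<tau> x *\<^sub>R w = x" by (simp add: base_def)

lemma base_height_eqI: "base x = base y \<Longrightarrow> \<tau> x = \<tau> y \<Longrightarrow> x = y"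
  by (metis base_height)

lemma push_simps [simp]: "base (push A x) = base x" "\<tau> (push A x) = real (rank A x)"
  by (simp_all add: push_def)

lemma finite_fibre [simp]: "finite A \<Longrightarrow> finite (fibre A u)"
  by (simp add: fibre_def)

lemma inj_on_height_fibre: "inj_on \<tau> (fibre A u)"
  by (auto simp: inj_on_def fibre_def dest: base_height_eqI)

lemma rank_less:
  assumes "finite A" "x \<in> A" "y \<in> A" "base x = base y" "\<tau> x < \<tau> y"
  shows "rank A x < rank A y"
  unfolding rank_def using assms by (intro psubset_card_mono) auto

lemma rank_image:
  assumes "finite A" shows "rank A ` fibre A u = {..<card (fibre A u)}"
proof -
  have "rank A x \<noteq> rank A y" if "x \<in> fibre A u" "y \<in> fibre A u" "x \<noteq> y" for x y
  proof -
    have "\<tau> x \<noteq> \<tau> y" using that inj_on_height_fibre[of A u] by (auto simp: inj_on_def)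
    then show ?thesis
      using that rank_less[of A x y] rank_less[of A y x] assms
      by (cases "\<tau> x < \<tau> y") (auto simp: fibre_def)
  qed
  then have "inj_on (rank A) (fibre A u)" by (auto simp: inj_on_def)
  then have "card (rank A ` fibre A u) = card (fibre A u)" by (rule card_image)
  moreover have "rank A x < card (fibre A u)" if "x \<in> fibre A u" for x
    unfolding rank_def using assms that by (intro psubset_card_mono) (auto simp: fibre_def)
  ultimately show ?thesis by (intro card_subset_eq) auto
qed

text \<open>The working description of a compression: on each line the ranks fill an initial segment
  of the naturals (\<open>rank_image\<close>), so only the fibre sizes of \<open>A\<close>
  matter.\<close>

lemma mem_compress:
  assumes "finite A"
  shows "x \<in> compress A \<longleftrightarrow> (\<exists>n<card (fibre A (base x)). \<tau> x = real n)"
proof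
  assume "x \<in> compress A"
  then obtain y where y: "y \<in> A" "x = push A y" by (auto simp: compress_def)
  then have "rank A y \<in> rank A ` fibre A (base x)" by (auto simp: fibre_def)
  then show "\<exists>n<card (fibre A (base x)). \<tau> x = real n"
    using y unfolding rank_image[OF assms] by auto
next
  assume "\<exists>n<card (fibre A (base x)). \<tau> x = real n"
  then obtain n where n: "n \<in> rank A ` fibre A (base x)" "\<tau> x = real n"
    unfolding rank_image[OF assms] by auto
  then obtain y where y: "y \<in> A" "base y = base x" "n = rank A y" by (auto simp: fibre_def)
  then have "push A y = x" using n(2) by - (rule base_height_eqI, simp_all)
  then show "x \<in> compress A" using y by (auto simp: compress_def)
qed

lemma inj_on_push: assumes "finite A" shows "inj_on (push A) A"
proof (rule inj_onI)
  fix x y assume h: "x \<in> A" "y \<in> A" "push A x = push A y"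
  have b: "base x = base y" using h(3) by (metis push_simps(1))
  have "rank A x = rank A y" using h(3) by (metis push_simps(2) of_nat_eq_iff)
  then have "\<tau> x = \<tau> y"
    using rank_less[OF assms h(1,2) b] rank_less[OF assms h(2,1) b[symmetric]] by linarith
  then show "x = y" using b base_height_eqI by blast
qed

lemma card_compress: "finite A \<Longrightarrow> card (compress A) = card A"
  unfolding compress_def by (intro card_image inj_on_push)

lemma finite_compress: "finite A \<Longrightarrow> finite (compress A)"
  unfolding compress_def by simp

text \<open>The height identifies a line parallel to \<open>w\<close> with the reals and reduces the
  claim to \<open>card_sumset_real\<close>.\<close>

lemma card_plus_line:
  assumes "finite P" "P \<noteq> {}" "finite Q" "Q \<noteq> {}"
    and "\<And>x. x \<in> P \<Longrightarrow> base x = u" "\<And>y. y \<in> Q \<Longrightarrow> base y = u'"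
  shows "card P + card Q \<le> card (P + Q) + 1"
proof -
  have i: "inj_on \<tau> S" if "\<And>x. x \<in> S \<Longrightarrow> base x = t" for S t
    using that by (auto simp: inj_on_def dest: base_height_eqI)
  have "\<tau> ` (P + Q) = \<tau> ` P + \<tau> ` Q"
  proof
    show "\<tau> ` (P + Q) \<subseteq> \<tau> ` P + \<tau> ` Q" by (auto elim!: set_plus_elim intro!: set_plus_intro)
    show "\<tau> ` P + \<tau> ` Q \<subseteq> \<tau> ` (P + Q)"
    proof
      fix t assume "t \<in> \<tau> ` P + \<tau> ` Q"
      then obtain x y where "x \<in> P" "y \<in> Q" "t = \<tau> (x + y)" by (auto elim!: set_plus_elim)
      then show "t \<in> \<tau> ` (P + Q)" by blast
    qed
  qed
  moreover have "card (\<tau> ` (P + Q)) = card (P + Q)"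
    by (rule card_image, rule i[of _ "u + u'"]) (use assms in \<open>auto simp: set_plus_def\<close>)
  moreover have "card (\<tau> ` P) = card P" "card (\<tau> ` Q) = card Q"
    using i assms by (blast intro: card_image)+
  ultimately show ?thesis using card_sumset_real[of "\<tau> ` P" "\<tau> ` Q"] assms by simp
qed

text \<open>Two fibres of sizes p and q contribute at least p + q - 1 points to one fibre of
  \<open>A + B\<close>, and p + q - 2 is the greatest height in the sum of their
  compressions.\<close>

lemma compress_plus_subset:
  assumes "finite A" "finite B"
  shows "compress A + compress B \<subseteq> compress (A + B)"
proof
  fix z assume "z \<in> compress A + compress B"
  then obtain x y where z: "z = x + y" "x \<in> compress A" "y \<in> compress B"
    by (auto simp: set_plus_def)
  obtain n m where n: "n < card (fibre A (base x))" "\<tau> x = real n"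
    and m: "m < card (fibre B (base y))" "\<tau> y = real m"
    using z assms by (auto simp: mem_compress)
  have "fibre A (base x) + fibre B (base y) \<subseteq> fibre (A + B) (base z)"
    by (auto simp: fibre_def set_plus_def z)
  then have "card (fibre A (base x) + fibre B (base y)) \<le> card (fibre (A + B) (base z))"
    using assms by (intro card_mono) (auto simp: finite_set_plus)
  moreover have "card (fibre A (base x)) + card (fibre B (base y))
      \<le> card (fibre A (base x) + fibre B (base y)) + 1"
  proof (rule card_plus_line)
    show "fibre A (base x) \<noteq> {}" "fibre B (base y) \<noteq> {}" using n m by force+
  qed (use assms in \<open>auto simp: fibre_def\<close>)
  ultimately have "n + m < card (fibre (A + B) (base z))" using n m by linarith
  then show "z \<in> compress (A + B)"
    using n m z assms by (auto simp: mem_compress finite_set_plus intro!: exI[of _ "n + m"])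
qed

lemma card_compress_plus:
  assumes "finite A" "finite B"
  shows "card (compress A + compress B) \<le> card (A + B)"
  using card_mono[OF _ compress_plus_subset[OF assms]] assms
  by (simp add: finite_compress finite_set_plus card_compress)

lemma base_mem_compress:
  assumes "finite A" "x \<in> A" shows "base x \<in> compress A"
proof -
  have "x \<in> fibre A (base x)" using assms by (simp add: fibre_def)
  then have "0 < card (fibre A (base x))" using assms card_gt_0_iff by force
  then show ?thesis using assms by (auto simp: mem_compress)
qed

lemma base_plus_mem_compress:
  assumes "finite A" "x \<in> A" "x + w \<in> A" shows "base x + w \<in> compress A"
proof -
  have "w \<noteq> 0" using height_w by force
  then have "card {x, x + w} = 2" by simp
  moreover have "card {x, x + w} \<le> card (fibre A (base x))"
    using assms by (intro card_mono) (auto simp: fibre_def)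
  ultimately show ?thesis
    using assms by (auto simp: mem_compress intro!: exI[of _ 1])
qed

lemma compress_fixed_diff_mem:
  assumes "finite A" "compress A = A" "x \<in> A" "\<tau> x \<ge> 1"
  shows "x - w \<in> A"
proof -
  obtain n where n: "n < card (fibre A (base x))" "\<tau> x = real n"
    using assms mem_compress[of A x] by auto
  then have "n - 1 < card (fibre A (base (x - w)))" "\<tau> (x - w) = real (n - 1)"
    using assms(4) by (auto simp: of_nat_diff)
  then have "x - w \<in> compress A"
    unfolding mem_compress[OF assms(1)] by blast
  then show ?thesis using assms by simp
qed

lemma rank_le:
  assumes "finite A" "\<And>x. x \<in> A \<Longrightarrow> \<tau> x \<in> \<nat>" "x \<in> A"
  shows "real (rank A x) \<le> \<tau> x"
proof -
  obtain n where n: "\<tau> x = real n" using assms(2)[OF assms(3)] by (rule Nats_cases)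
  let ?Y = "{y \<in> A. base y = base x \<and> \<tau> y < \<tau> x}"
  have "\<tau> ` ?Y \<subseteq> real ` {..<n}"
  proof
    fix t assume "t \<in> \<tau> ` ?Y"
    then obtain y where "y \<in> A" "t = \<tau> y" "\<tau> y < real n" using n by auto
    moreover from this obtain m where "\<tau> y = real m" using assms(2) Nats_cases by blast
    ultimately show "t \<in> real ` {..<n}" by simp
  qed
  then have "card (\<tau> ` ?Y) \<le> card (real ` {..<n})" by (intro card_mono) auto
  moreover have "card (\<tau> ` ?Y) = card ?Y"
    by (intro card_image inj_on_subset[OF inj_on_height_fibre[of A "base x"]]) (auto simp: fibre_def)
  moreover have "card (real ` {..<n}) = n" by (simp add: card_image)
  ultimately show ?thesis by (simp add: rank_def n)
qed

lemma push_eq: "push A x = x - (\<tau> x - real (rank A x)) *\<^sub>R w"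
  unfolding push_def base_def by (simp add: scaleR_left_diff_distrib)

text \<open>Each point moves down by a nonnegative multiple of \<open>w\<close>
  (\<open>rank_le\<close>), and \<open>\<phi>\<close> is positive on \<open>w\<close>. By the second
  part a compression that changes \<open>A\<close> strictly lowers the sum; this is why minimal
  pairs are stable.\<close>

lemma compress_potential:
  assumes A: "finite A" "\<And>x. x \<in> A \<Longrightarrow> \<tau> x \<in> \<nat>"
    and \<phi>: "linear \<phi>" "\<phi> w > (0::real)"
  shows "(\<Sum>x\<in>compress A. \<phi> x) \<le> (\<Sum>x\<in>A. \<phi> x)"
    and "(\<Sum>x\<in>compress A. \<phi> x) = (\<Sum>x\<in>A. \<phi> x) \<Longrightarrow> compress A = A"
proof -
  have eq: "(\<Sum>x\<in>compress A. \<phi> x) = (\<Sum>x\<in>A. \<phi> (push A x))"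
    unfolding compress_def using inj_on_push[OF A(1)] by (simp add: sum.reindex)
  have p: "\<phi> (push A x) = \<phi> x - (\<tau> x - real (rank A x)) * \<phi> w" for x
    using \<phi>(1) by (simp add: push_eq linear_diff linear_scale)
  have le: "\<phi> (push A x) \<le> \<phi> x" if "x \<in> A" for x
    using rank_le[OF A that] \<phi>(2) by (simp add: p)
  then show "(\<Sum>x\<in>compress A. \<phi> x) \<le> (\<Sum>x\<in>A. \<phi> x)"
    unfolding eq by (intro sum_mono)
  assume "(\<Sum>x\<in>compress A. \<phi> x) = (\<Sum>x\<in>A. \<phi> x)"
  then have "(\<Sum>x\<in>A. \<phi> x - \<phi> (push A x)) = 0" by (simp add: eq sum_subtractf)
  then have "\<phi> x - \<phi> (push A x) = 0" if "x \<in> A" for x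
    using that le A(1) by (subst (asm) sum_nonneg_eq_0_iff) auto
  then have "\<tau> x = real (rank A x)" if "x \<in> A" for x
    using that \<phi>(2) by (simp add: p)
  then have "push A x = x" if "x \<in> A" for x
    using that by (simp add: push_eq)
  then show "compress A = A" by (simp add: compress_def)
qed

text \<open>\<open>R\<close> is constant on lines parallel to \<open>w\<close>, so restricting to
  \<open>R\<close> removes whole lines and leaves the ranks alone. Used for the level of z-height 0,
  whose size is the number of lines parallel to \<open>unit z\<close>.\<close>

lemma compress_sep:
  assumes "finite A" and R: "\<And>x y. x - y \<in> range (\<lambda>t. t *\<^sub>R w) \<Longrightarrow> R x = R y"
  shows "{x \<in> compress A. R x} = compress {x \<in> A. R x}"
proof -
  have RI: "R x = R y" if "base x = base y" for x y
  proof (rule R)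
    have "x - y = (\<tau> x - \<tau> y) *\<^sub>R w" 
      using that by - (rule base_height_eqI, auto)
    then show "x - y \<in> range (\<lambda>t. t *\<^sub>R w)" by blast
  qed
  have "rank {x \<in> A. R x} x = rank A x" if "R x" for x
    unfolding rank_def using RI that by (intro arg_cong[where f = card]) blast
  then have "push {x \<in> A. R x} x = push A x" if "R x" for x
    using that by (simp add: push_def)
  moreover have "R (push A x) = R x" for x by (rule RI) simp
  ultimately show ?thesis unfolding compress_def by auto
qed

text \<open>Translation by \<open>- s\<close> keeps heights and maps the fibre through
  \<open>x\<close> injectively into another one, so the latter is at least as long. This carries
  down-closedness in direction z through later compressions.\<close>

lemma compress_translate:
  assumes "finite A" "\<tau> s = 0" and "\<And>y. y \<in> A \<Longrightarrow> base y = base x \<Longrightarrow> y - s \<in> A"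
    and "x \<in> compress A"
  shows "x - s \<in> compress A"
proof -
  have b: "base s = s" using assms(2) by (rule base_eq_self)
  have "(\<lambda>y. y - s) ` fibre A (base x) \<subseteq> fibre A (base (x - s))"
    using assms(3) by (auto simp: fibre_def)
  then have "card ((\<lambda>y. y - s) ` fibre A (base x)) \<le> card (fibre A (base (x - s)))"
    using assms(1) by (intro card_mono) auto
  moreover have "card ((\<lambda>y. y - s) ` fibre A (base x)) = card (fibre A (base x))"
    by (intro card_image) (auto simp: inj_on_def)
  ultimately show ?thesis
    using assms by (auto simp: mem_compress simp del: base_simps intro: less_le_trans)
qed

text \<open>Adding a subset of one line keeps the lines of \<open>P\<close> apart, and each of them
  gains at least |Q| - 1 points. The gain from adding a tooth is counted in this way.\<close>

lemma card_plus_lines: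
  assumes P: "finite P" and Q: "finite Q" "Q \<noteq> {}" "\<And>y. y \<in> Q \<Longrightarrow> base y = u"
  shows "card P + card (base ` P) * (card Q - 1) \<le> card (P + Q)"
proof -
  have eq: "P + Q = (\<Union>t\<in>base ` P. fibre P t + Q)"
    by (auto simp: set_plus_def fibre_def)
  have "card (P + Q) = (\<Sum>t\<in>base ` P. card (fibre P t + Q))"
    unfolding eq
  proof (rule card_UN_disjoint)
    show "\<forall>i\<in>base ` P. \<forall>j\<in>base ` P. i \<noteq> j \<longrightarrow> (fibre P i + Q) \<inter> (fibre P j + Q) = {}"
    proof (intro ballI impI equals0I)
      fix i j z assume "i \<noteq> j" and z: "z \<in> (fibre P i + Q) \<inter> (fibre P j + Q)"
      have "base z = t + u" if "z \<in> fibre P t + Q" for t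
        using that Q(3) by (auto simp: fibre_def elim!: set_plus_elim)
      then have "base z = i + u" "base z = j + u" using z by auto
      then show False using \<open>i \<noteq> j\<close> by simp
    qed
  qed (use P Q in \<open>auto simp: finite_set_plus\<close>)
  also have "\<dots> \<ge> (\<Sum>t\<in>base ` P. card (fibre P t) + (card Q - 1))"
  proof (rule sum_mono)
    fix t assume "t \<in> base ` P"
    then have "card (fibre P t) + card Q \<le> card (fibre P t + Q) + 1"
      using P Q by (intro card_plus_line[of _ _ t u]) (auto simp: fibre_def)
    moreover have "card Q > 0" using Q by (simp add: card_gt_0_iff)
    ultimately show "card (fibre P t) + (card Q - 1) \<le> card (fibre P t + Q)" by linarith
  qed
  moreover have "(\<Sum>t\<in>base ` P. card (fibre P t)) = card P"
    using sum.image_gen[OF P, of "\<lambda>_. 1::nat" base] by (simp add: fibre_def)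
  ultimately show ?thesis by (simp add: sum.distrib)
qed

text \<open>Either no line contains two points and compression is the linear projection
  \<open>base\<close>, or \<open>w\<close> is a multiple of a difference of points of
  \<open>B\<close> and moving along \<open>w\<close> stays in the affine hull.\<close>

lemma aff_dim_compress_le:
  assumes "finite B" shows "aff_dim (compress B) \<le> aff_dim B"
proof (cases "inj_on base B")
  case True
  then have "rank B x = 0" if "x \<in> B" for x
    using that assms by (auto simp: rank_def inj_on_def)
  then have "compress B = base ` B" by (simp add: compress_def push_def)
  then show ?thesis by (simp add: aff_dim_linear_image_le linear_base)
next
  case False
  then obtain b b' where b: "b \<in> B" "b' \<in> B" "base b = base b'" "b \<noteq> b'"
    by (auto simp: inj_on_def)
  let ?V = "span ((\<lambda>x. x - b) ` B)"
  have "b' - b = (\<tau> b' - \<tau> b) *\<^sub>R w"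
    using b by - (rule base_height_eqI, auto)
  moreover have "\<tau> b' \<noteq> \<tau> b" using b base_height_eqI by metis
  ultimately have "w = inverse (\<tau> b' - \<tau> b) *\<^sub>R (b' - b)" by simp
  moreover have "inverse (\<tau> b' - \<tau> b) *\<^sub>R (b' - b) \<in> ?V"
    using b(2) by (intro span_scale span_base) auto
  ultimately have w: "w \<in> ?V" by simp
  have "compress B \<subseteq> (\<lambda>x. b + x) ` ?V"
  proof
    fix x assume "x \<in> compress B"
    then obtain y where y: "y \<in> B" "x = push B y" by (auto simp: compress_def)
    have "x - b = (y - b) - (\<tau> y - real (rank B y)) *\<^sub>R w" by (simp add: y push_eq)
    also have "\<dots> \<in> ?V"
      using y(1) w by (intro span_diff[OF span_base span_scale]) auto
    finally show "x \<in> (\<lambda>x. b + x) ` ?V" by (rule rev_image_eqI) simp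
  qed
  then have "aff_dim (compress B) \<le> aff_dim ((\<lambda>x. b + x) ` ?V)" by (rule aff_dim_subset)
  also have "\<dots> = int (dim ?V)" by (simp add: aff_dim_translation_eq aff_dim_subspace)
  also have "\<dots> = aff_dim B"
    using b by (subst aff_dim_eq_dim_subtract[of b]) (auto simp: hull_inc)
  finally show ?thesis .
qed

end

section \<open>Reduction to lattice sets\<close>

lemma compression_coordinate:
  fixes w :: "real ^ 'n" assumes "w $ k = 1" shows "compression w (\<lambda>x. x $ k)"
  using assms by unfold_locales (auto intro!: linearI)

abbreviation squash :: "'n \<Rightarrow> real ^ 'n \<Rightarrow> (real ^ 'n) set \<Rightarrow> (real ^ 'n) set" where
  "squash k w \<equiv> compression.compress w (\<lambda>x. x $ k)"

abbreviation unit :: "'n \<Rightarrow> real ^ 'n" where "unit i \<equiv> axis i 1"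

text \<open>For a set that is down-closed in direction \<open>z\<close>, the number \<open>r\<close> of points at height \<open>0\<close> is
  the number of lines parallel to \<open>unit z\<close> that meet it.\<close>

definition stacked :: "'n \<Rightarrow> nat \<Rightarrow> nat \<Rightarrow> (real ^ 'n) set \<Rightarrow> bool" where
  "stacked z a r A \<longleftrightarrow> finite A \<and> card A = a \<and> card {x \<in> A. x $ z = 0} = r \<and>
    (\<forall>x\<in>A. x $ z \<in> \<nat> \<and> (x $ z \<ge> 1 \<longrightarrow> x - unit z \<in> A))"

text \<open>Such a compression preserves coordinate z of every point, so it acts on each z-level
  separately.\<close>

lemma stacked_squash:
  assumes w: "w $ k = 1" "w $ z = 0" and A: "stacked z a r A"
  shows "stacked z a r (squash k w A)"
proof -
  have kz: "k \<noteq> z" using w by auto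
  interpret compression w "\<lambda>x. x $ k" by (rule compression_coordinate) fact
  have fin: "finite A" using A by (simp add: stacked_def)
  have base_z: "base x $ z = x $ z" for x by (simp add: base_def w)
  have push_z: "push A x $ z = x $ z" for x by (simp add: push_eq w)
  have "{x \<in> compress A. x $ z = 0} = compress {x \<in> A. x $ z = 0}"
  proof (rule compress_sep[OF fin])
    fix x y assume "x - y \<in> range (\<lambda>t. t *\<^sub>R w)"
    then obtain t where "x - y = t *\<^sub>R w" by blast
    then have "(x - y) $ z = 0" using w(2) by simp
    then show "(x $ z = 0) = (y $ z = 0)" by simp
  qed
  then have "card {x \<in> compress A. x $ z = 0} = r"
    using A fin by (simp add: card_compress stacked_def)
  moreover have "x $ z \<in> \<nat> \<and> (x $ z \<ge> 1 \<longrightarrow> x - unit z \<in> compress A)" if x: "x \<in> compress A" for x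
  proof
    show "x $ z \<in> \<nat>" using x A by (auto simp: compress_def push_z stacked_def)
    show "x $ z \<ge> 1 \<longrightarrow> x - unit z \<in> compress A"
    proof
      assume "x $ z \<ge> 1"
      then have "y - unit z \<in> A" if "y \<in> A" "base y = base x" for y
        using that A base_z by (metis stacked_def)
      then show "x - unit z \<in> compress A"
        using kz x fin by (intro compress_translate) (auto simp: axis_def)
    qed
  qed
  ultimately show ?thesis
    using A fin by (simp add: stacked_def card_compress finite_compress)
qed

section \<open>Lattice pairs and their stability under admissible compressions\<close>

text \<open>The parameters \<open>\<sigma>\<close>, \<open>a\<close>, \<open>b\<close>, \<open>r\<close>, \<open>s\<close>, \<open>c\<close> record the data of the original pair: \<open>|A + B|\<close>,
  \<open>|A|\<close>, \<open>|B|\<close>, the numbers of lines, and the dimension of \<open>B\<close>. The unit vectors in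
  \<open>S\<close> have to stay in both sets.\<close>

definition lattice_pair :: "'n \<Rightarrow> 'n set \<Rightarrow> nat \<Rightarrow> nat \<Rightarrow> nat \<Rightarrow> nat \<Rightarrow> nat \<Rightarrow> int
    \<Rightarrow> (real ^ 'n) set \<Rightarrow> (real ^ 'n) set \<Rightarrow> bool" where
  "lattice_pair z S \<sigma> a b r s c A B \<longleftrightarrow> stacked z a r A \<and> stacked z b s B \<and>
    card (A + B) \<le> \<sigma> \<and> aff_dim B \<le> c \<and> (\<forall>x\<in>A \<union> B. \<forall>i. x $ i \<in> \<nat>) \<and> 0 \<in> A \<and> 0 \<in> B \<and>
    (\<forall>i. i \<noteq> z \<longrightarrow> unit i \<in> A \<or> unit i \<in> B) \<and> (\<forall>i\<in>S. unit i \<in> A \<and> unit i \<in> B)"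

text \<open>A point descends \<open>n - rank A y\<close> steps, and each step adds the natural
  number \<open>- w $ i\<close> to a coordinate \<open>i\<close> other than
  \<open>k\<close>.\<close>

lemma squash_coordinates:
  assumes w: "w $ k = 1" "\<And>i. i \<noteq> k \<Longrightarrow> - w $ i \<in> \<nat>"
    and A: "finite A" "\<And>x i. x \<in> A \<Longrightarrow> x $ i \<in> \<nat>" and x: "x \<in> squash k w A"
  shows "x $ i \<in> \<nat>"
proof -
  interpret compression w "\<lambda>x. x $ k" by (rule compression_coordinate) fact
  obtain y where y: "y \<in> A" "x = push A y" using x by (auto simp: compress_def)
  show ?thesis
  proof (cases "i = k")
    case True
    then show ?thesis using y push_simps(2)[of A y] by simp
  next
    case False
    obtain n where n: "y $ k = real n" using A(2)[OF y(1)] Nats_cases by blast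
    have "rank A y \<le> n" using rank_le[of A y] A y n by auto
    then have "x $ i = y $ i + real (n - rank A y) * (- w $ i)"
      by (simp add: y push_eq n of_nat_diff algebra_simps)
    then show ?thesis using A(2)[OF y(1)] w(2)[OF False] by (metis Nats_add Nats_mult of_nat_in_Nats)
  qed
qed

lemma squash_unit:
  assumes "w $ k = 1" "finite A" "unit i \<in> A" "i \<noteq> k"
  shows "unit i \<in> squash k w A"
proof -
  interpret compression w "\<lambda>x. x $ k" by (rule compression_coordinate) fact
  have "base (unit i) = unit i" using assms(4) by (intro base_eq_self) (simp add: axis_def)
  then show ?thesis using base_mem_compress[OF assms(2,3)] by simp
qed

text \<open>\<open>unit k\<close> and \<open>unit k - w\<close> lie on one line, which therefore
  carries two points and keeps height 1 occupied.\<close>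

lemma squash_unit_self:
  assumes "w $ k = 1" "finite A" "unit k \<in> A" "unit k - w \<in> A"
  shows "unit k \<in> squash k w A"
proof -
  interpret compression w "\<lambda>x. x $ k" by (rule compression_coordinate) fact
  have "base (unit k - w) = unit k - w" using assms(1) by (intro base_eq_self) simp
  then show ?thesis using base_plus_mem_compress[OF assms(2,4)] assms(3) by simp
qed

lemma squash_zero:
  assumes "w $ k = 1" "finite A" "0 \<in> A"
  shows "0 \<in> squash k w A"
proof -
  interpret compression w "\<lambda>x. x $ k" by (rule compression_coordinate) fact
  show ?thesis using base_mem_compress[OF assms(2,3)] by simp
qed

lemma lattice_pair_squash:
  assumes w: "w $ k = 1" "w $ z = 0" "\<And>i. i \<noteq> k \<Longrightarrow> - w $ i \<in> \<nat>"
    and P: "lattice_pair z S \<sigma> a b r s c A B"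
    and k: "unit k \<in> A \<and> unit k - w \<in> A \<or> unit k \<in> B \<and> unit k - w \<in> B" "k \<in> S \<Longrightarrow> w = unit k"
  shows "lattice_pair z S \<sigma> a b r s c (squash k w A) (squash k w B)"
proof -
  interpret compression w "\<lambda>x. x $ k" by (rule compression_coordinate) fact
  have fin: "finite A" "finite B" using P by (auto simp: lattice_pair_def stacked_def)
  have "card (compress A + compress B) \<le> \<sigma>" "aff_dim (compress B) \<le> c"
    using card_compress_plus[OF fin] aff_dim_compress_le[OF fin(2)] P
    by (auto simp: lattice_pair_def)
  moreover have "x $ i \<in> \<nat>" if "x \<in> compress A \<union> compress B" for x i
    using that P squash_coordinates[OF w(1,3) fin(1)] squash_coordinates[OF w(1,3) fin(2)]
    unfolding lattice_pair_def by blast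
  moreover have "unit i \<in> compress A \<or> unit i \<in> compress B" if "i \<noteq> z" for i
    using that P k(1) squash_unit[OF w(1)] squash_unit_self[OF w(1)] fin
    unfolding lattice_pair_def by (cases "i = k") blast+
  moreover have "unit i \<in> compress A \<and> unit i \<in> compress B" if "i \<in> S" for i
  proof (cases "i = k")
    case True
    \<comment> \<open>For a protected \<open>k\<close> the second point on the line is 0, which lies
      in both sets.\<close>
    then have "unit k - w = 0" using k(2) that by simp
    then show ?thesis
      using that P squash_unit_self[OF w(1)] fin True unfolding lattice_pair_def by metis
  next
    case False
    then show ?thesis using that P squash_unit[OF w(1)] fin unfolding lattice_pair_def by blast
  qed
  ultimately show ?thesis
    using P stacked_squash[OF w(1,2)] squash_zero[OF w(1)] fin unfolding lattice_pair_def by blast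
qed

text \<open>The condition on \<open>unit k\<close> guarantees that \<open>unit k\<close> survives the compression in \<open>A\<close> or in \<open>B\<close>.\<close>

definition squash_stable :: "'n \<Rightarrow> 'n set \<Rightarrow> ('n::finite \<Rightarrow> nat) \<Rightarrow> (real ^ 'n) set \<Rightarrow> (real ^ 'n) set \<Rightarrow> bool" where
  "squash_stable z S wt A B \<longleftrightarrow> (\<forall>k w. w $ k = 1 \<longrightarrow> w $ z = 0 \<longrightarrow> (\<forall>i. i \<noteq> k \<longrightarrow> - w $ i \<in> \<nat>) \<longrightarrow>
    (\<Sum>i\<in>UNIV. wt i * w $ i) > 0 \<longrightarrow>
    unit k \<in> A \<and> unit k - w \<in> A \<or> unit k \<in> B \<and> unit k - w \<in> B \<longrightarrow> (k \<in> S \<longrightarrow> w = unit k) \<longrightarrow>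
    squash k w A = A \<and> squash k w B = B)"

text \<open>A minimum of the weighted coordinate sum \<open>\<Phi>\<close> over all lattice pairs
  with these parameters is stable: an admissible compression yields another such pair and raises
  neither of the two sums.\<close>

lemma minimal_lattice_pair:
  fixes wt :: "'n::finite \<Rightarrow> nat"
  assumes "lattice_pair z S \<sigma> a b r s c A0 (B0 :: (real ^ 'n) set)"
  obtains A B where "lattice_pair z S \<sigma> a b r s c A B" "squash_stable z S wt A B"
proof -
  define \<phi> where "\<phi> x = (\<Sum>i\<in>UNIV. wt i * x $ i)" for x :: "real ^ 'n"
  define \<Phi> where "\<Phi> P = sum \<phi> (fst P) + sum \<phi> (snd P)" for P
  have lin: "linear \<phi>" unfolding \<phi>_def
    by (rule linearI) (simp_all add: sum.distrib sum_distrib_left algebra_simps)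
  let ?Q = "\<lambda>P. lattice_pair z S \<sigma> a b r s c (fst P) (snd P)"
  have nat: "\<Phi> P \<in> \<nat>" if "?Q P" for P
  proof -
    have sum_Nats: "sum f X \<in> \<nat>" if "\<And>x. x \<in> X \<Longrightarrow> f x \<in> \<nat>" for f :: "'b \<Rightarrow> real" and X
      using that by (induction X rule: infinite_finite_induct) auto
    have "\<phi> x \<in> \<nat>" if "x \<in> fst P \<union> snd P" for x
      unfolding \<phi>_def using that \<open>?Q P\<close>
      by (intro sum_Nats Nats_mult) (auto simp: lattice_pair_def)
    then show ?thesis unfolding \<Phi>_def by (intro Nats_add sum_Nats) auto
  qed
  obtain P where P: "?Q P" and min: "\<And>P'. ?Q P' \<Longrightarrow> nat \<lfloor>\<Phi> P\<rfloor> \<le> nat \<lfloor>\<Phi> P'\<rfloor>"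
    using ex_has_least_nat[of ?Q "(A0, B0)" "\<lambda>P. nat \<lfloor>\<Phi> P\<rfloor>"] assms by auto
  \<comment> \<open>\<open>\<Phi>\<close> takes natural values, so the floor used for the minimum
    loses nothing.\<close>
  have min: "\<Phi> P \<le> \<Phi> P'" if "?Q P'" for P'
    using min[OF that] nat[OF P] nat[OF that] by (auto elim!: Nats_cases)
  obtain A B where AB: "P = (A, B)" by (cases P)
  show thesis
  proof (rule that[of A B])
    show "lattice_pair z S \<sigma> a b r s c A B" using P AB by simp
    show "squash_stable z S wt A B"
      unfolding squash_stable_def
    proof (intro allI impI)
      fix k w
      assume w: "w $ k = 1" "w $ z = 0" and wn: "\<forall>i. i \<noteq> k \<longrightarrow> - w $ i \<in> \<nat>" and wp: "(\<Sum>i\<in>UNIV. wt i * w $ i) > 0"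
        and k: "unit k \<in> A \<and> unit k - w \<in> A \<or> unit k \<in> B \<and> unit k - w \<in> B" and kS: "k \<in> S \<longrightarrow> w = unit k"
      interpret compression w "\<lambda>x. x $ k" by (rule compression_coordinate) fact
      have Q: "?Q (compress A, compress B)"
        using lattice_pair_squash[OF w _ _ k] wn kS P AB by simp
      have pos: "\<phi> w > 0" using wp by (simp add: \<phi>_def)
      have A: "finite A" and nA: "\<And>x. x \<in> A \<Longrightarrow> x $ k \<in> \<nat>"
        and B: "finite B" and nB: "\<And>x. x \<in> B \<Longrightarrow> x $ k \<in> \<nat>"
        using P AB by (auto simp: lattice_pair_def stacked_def)
      have "sum \<phi> (compress A) \<le> sum \<phi> A" "sum \<phi> (compress B) \<le> sum \<phi> B"
        using compress_potential(1)[OF A nA lin pos] compress_potential(1)[OF B nB lin pos] by auto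
      moreover have "sum \<phi> A + sum \<phi> B \<le> sum \<phi> (compress A) + sum \<phi> (compress B)"
        using min[OF Q] by (simp add: \<Phi>_def AB)
      ultimately have "sum \<phi> (compress A) = sum \<phi> A" "sum \<phi> (compress B) = sum \<phi> B" by linarith+
      then show "compress A = A \<and> compress B = B"
        using compress_potential(2)[OF A nA lin pos] compress_potential(2)[OF B nB lin pos] by simp
    qed
  qed
qed

text \<open>Compressing along z first turns the line counts into the sizes of z-level 0; the
  remaining axes follow one by one and preserve these sizes.\<close>

lemma axis_compression_to_lattice:
  fixes A B :: "(real ^ 'n) set"
  assumes fin: "finite A" "A \<noteq> {}" "finite B" "B \<noteq> {}"
    and diff: "\<And>i. i \<noteq> z \<Longrightarrow> (\<exists>x\<in>A. x + unit i \<in> A) \<or> (\<exists>x\<in>B. x + unit i \<in> B)"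
    and r: "card ((\<lambda>x. x - x $ z *\<^sub>R unit z) ` A) = r" "card ((\<lambda>x. x - x $ z *\<^sub>R unit z) ` B) = s"
  obtains A' B' where "lattice_pair z {} (card (A + B)) (card A) (card B) r s (aff_dim B) A' B'"
proof -
  \<comment> \<open>\<open>F\<close> collects the axes treated so far. The base points
    \<open>x\<close> have zero coordinates in \<open>F\<close> only; with \<open>F = UNIV\<close>
    they are forced to be 0, so that 0 and the unit vectors themselves end up in the sets.\<close>
  define I where "I F A' B' \<longleftrightarrow> stacked z (card A) r A' \<and> stacked z (card B) s B' \<and>
    card (A' + B') \<le> card (A + B) \<and> aff_dim B' \<le> aff_dim B \<and>
    (\<forall>x\<in>A' \<union> B'. \<forall>i\<in>F. x $ i \<in> \<nat>) \<and>
    (\<exists>x\<in>A'. \<forall>j\<in>F. x $ j = 0) \<and> (\<exists>x\<in>B'. \<forall>j\<in>F. x $ j = 0) \<and>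
    (\<forall>i. i \<noteq> z \<longrightarrow> (\<exists>x\<in>A'. (\<forall>j\<in>F. x $ j = 0) \<and> x + unit i \<in> A') \<or>
       (\<exists>x\<in>B'. (\<forall>j\<in>F. x $ j = 0) \<and> x + unit i \<in> B'))" for F A' B'
  have "\<exists>A' B'. I (insert z F) A' B'" if "finite F" "z \<notin> F" for F
    using that
  proof (induction F rule: finite_induct)
    case empty
    interpret compression "unit z" "\<lambda>x. x $ z" by (rule compression_coordinate) simp
    have st: "stacked z (card X) (card (base ` X)) (compress X)" if "finite X" for X
    proof -
      have "{x \<in> compress X. x $ z = 0} = base ` X"
      proof (intro equalityI subsetI)
        fix x assume "x \<in> {x \<in> compress X. x $ z = 0}"
        then obtain y where "y \<in> X" "x = push X y" "base x = x"
          using base_eq_self[of x] by (auto simp: compress_def)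
        then show "x \<in> base ` X" by (metis image_eqI push_simps(1))
      next
        fix x assume "x \<in> base ` X"
        then show "x \<in> {x \<in> compress X. x $ z = 0}"
          using base_mem_compress[OF that] base_simps(6) by auto
      qed
      moreover have "x $ z \<in> \<nat>" if "x \<in> compress X" for x
        using that \<open>finite X\<close> by (auto simp: mem_compress)
      moreover have "x - unit z \<in> compress X" if x: "x \<in> compress X" "x $ z \<ge> 1" for x
      proof -
        obtain n where n: "n < card (fibre X (base x))" "x $ z = real n"
          using x \<open>finite X\<close> by (auto simp: mem_compress)
        then have "n - 1 < card (fibre X (base (x - unit z)))" "(x - unit z) $ z = real (n - 1)"
          using x by (auto simp: of_nat_diff)
        then show ?thesis unfolding mem_compress[OF \<open>finite X\<close>] by blast
      qed
      ultimately show ?thesis using that by (simp add: stacked_def card_compress finite_compress)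
    qed
    have zero: "\<exists>x\<in>compress X. x $ z = 0" if "finite X" "X \<noteq> {}" for X
      using that base_mem_compress[of X] base_simps(6) by blast
    have step: "\<exists>x\<in>compress X. x $ z = 0 \<and> x + unit i \<in> compress X"
      if "finite X" "x \<in> X" "x + unit i \<in> X" "i \<noteq> z" for X x i
    proof -
      have "base (unit i) = unit i" using that(4) by (intro base_eq_self) (simp add: axis_def)
      then show ?thesis
        using base_mem_compress[OF that(1,2)] base_mem_compress[OF that(1,3)] base_simps(1,6) by metis
    qed
    have "(\<exists>x\<in>compress A. x $ z = 0 \<and> x + unit i \<in> compress A) \<or>
        (\<exists>x\<in>compress B. x $ z = 0 \<and> x + unit i \<in> compress B)" if "i \<noteq> z" for i
      using diff[OF that] step[OF fin(1)] step[OF fin(3)] that by blast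
    moreover have "stacked z (card A) r (compress A)" "stacked z (card B) s (compress B)"
      using st[OF fin(1)] st[OF fin(3)] r by (simp_all add: base_def)
    ultimately have "I {z} (compress A) (compress B)"
      unfolding I_def using zero[OF fin(1,2)] zero[OF fin(3,4)]
        card_compress_plus[OF fin(1,3)] aff_dim_compress_le[OF fin(3)]
      by (auto simp: stacked_def)
    then show ?case by blast
  next
    case (insert k F)
    then obtain A' B' where I: "I (insert z F) A' B'" by auto
    interpret compression "unit k" "\<lambda>x. x $ k" by (rule compression_coordinate) simp
    have kz: "k \<noteq> z" using insert by auto
    have fin': "finite A'" "finite B'" using I by (auto simp: I_def stacked_def)
    have base_other: "base x $ j = x $ j" if "j \<noteq> k" for x j
      unfolding base_def using that by (simp add: axis_def)
    have push_other: "push X x $ j = x $ j" if "j \<noteq> k" for X x j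
      unfolding push_eq using that by (simp add: axis_def)
    have nat: "x $ i \<in> \<nat>" if "i \<in> insert z (insert k F)" "x \<in> compress X" "finite X"
      "\<forall>x\<in>X. \<forall>i\<in>insert z F. x $ i \<in> \<nat>" for X x i
    proof (cases "i = k")
      case True then show ?thesis using that by (auto simp: mem_compress)
    next
      case False
      then show ?thesis using that by (auto simp: compress_def push_other)
    qed
    have zero: "\<exists>x\<in>compress X. \<forall>j\<in>insert z (insert k F). x $ j = 0"
      if X: "finite X" "\<exists>x\<in>X. \<forall>j\<in>insert z F. x $ j = 0" for X
    proof -
      obtain x where x: "x \<in> X" "\<forall>j\<in>insert z F. x $ j = 0" using X by auto
      have "base x $ j = 0" if "j \<in> insert z (insert k F)" for j
        using x that base_other by (cases "j = k") auto
      then show ?thesis using base_mem_compress[OF X(1) x(1)] by blast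
    qed
    have step: "\<exists>x\<in>compress X. (\<forall>j\<in>insert z (insert k F). x $ j = 0) \<and> x + unit i \<in> compress X"
      if X: "finite X" "\<exists>x\<in>X. (\<forall>j\<in>insert z F. x $ j = 0) \<and> x + unit i \<in> X" for X i
    proof -
      obtain x where x: "x \<in> X" "\<forall>j\<in>insert z F. x $ j = 0" "x + unit i \<in> X" using X by auto
      have "base x $ j = 0" if "j \<in> insert z (insert k F)" for j
        using x that base_other by (cases "j = k") auto
      moreover have "base x + unit i \<in> compress X"
      \<comment> \<open>For \<open>i = k\<close> the points \<open>x\<close> and
        \<open>x + unit k\<close> share a line, which keeps height 1; otherwise both are projected
        to height 0.\<close>
      proof (cases "i = k")
        case True
        then show ?thesis using base_plus_mem_compress[OF X(1) x(1)] x(3) by simp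
      next
        case False
        then have "base (unit i) = unit i" by (intro base_eq_self) (simp add: axis_def)
        then show ?thesis using base_mem_compress[OF X(1) x(3)] by simp
      qed
      ultimately show ?thesis using base_mem_compress[OF X(1) x(1)] by blast
    qed
    have "I (insert z (insert k F)) (compress A') (compress B')"
      unfolding I_def
    proof (intro conjI allI impI)
      show "stacked z (card A) r (compress A')" "stacked z (card B) s (compress B')"
        using I kz by (auto simp: I_def axis_def intro!: stacked_squash)
      show "card (compress A' + compress B') \<le> card (A + B)"
        using card_compress_plus[OF fin'] I by (simp add: I_def)
      show "aff_dim (compress B') \<le> aff_dim B"
        using aff_dim_compress_le[OF fin'(2)] I by (simp add: I_def)
      show "\<forall>x\<in>compress A' \<union> compress B'. \<forall>i\<in>insert z (insert k F). x $ i \<in> \<nat>"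
      proof (intro ballI)
        fix x i assume "x \<in> compress A' \<union> compress B'" and i: "i \<in> insert z (insert k F)"
        moreover have "\<forall>x\<in>A' \<union> B'. \<forall>i\<in>insert z F. x $ i \<in> \<nat>" using I unfolding I_def by argo
        ultimately show "x $ i \<in> \<nat>"
          using nat[OF i _ fin'(1), of x] nat[OF i _ fin'(2), of x] by fast
      qed
      show "\<exists>x\<in>compress A'. \<forall>j\<in>insert z (insert k F). x $ j = 0"
        "\<exists>x\<in>compress B'. \<forall>j\<in>insert z (insert k F). x $ j = 0"
        by (rule zero; use I fin' in \<open>simp add: I_def\<close>)+
      fix i assume "i \<noteq> z"
      then have "(\<exists>x\<in>A'. (\<forall>j\<in>insert z F. x $ j = 0) \<and> x + unit i \<in> A') \<or>
          (\<exists>x\<in>B'. (\<forall>j\<in>insert z F. x $ j = 0) \<and> x + unit i \<in> B')"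
        using I unfolding I_def by metis
      then show "(\<exists>x\<in>compress A'. (\<forall>j\<in>insert z (insert k F). x $ j = 0) \<and> x + unit i \<in> compress A') \<or>
       (\<exists>x\<in>compress B'. (\<forall>j\<in>insert z (insert k F). x $ j = 0) \<and> x + unit i \<in> compress B')"
        using step[OF fin'(1), of i] step[OF fin'(2), of i] by argo
    qed
    then show ?case by blast
  qed
  from this[of "UNIV - {z}"] obtain A' B' where I: "I UNIV A' B'"
    by (auto simp: insert_UNIV)
  have z: "x = 0 \<longleftrightarrow> (\<forall>j\<in>UNIV. x $ j = 0)" for x :: "real ^ 'n" by (simp add: vec_eq_iff)
  have "lattice_pair z {} (card (A + B)) (card A) (card B) r s (aff_dim B) A' B'"
    using I unfolding I_def lattice_pair_def z[symmetric] by auto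
  then show thesis by (rule that)
qed

section \<open>Sumsets of combs\<close>

lemma weighted_average_le:
  fixes p q u v x :: real
  assumes "(p + q) * u \<le> x" "(p + q) * v \<le> x" "p > 0" "q > 0"
  shows "p * u + q * v \<le> x"
proof -
  have "(p + q) * (p * u + q * v) = p * ((p + q) * u) + q * ((p + q) * v)"
    by (simp add: algebra_simps)
  also have "\<dots> \<le> p * x + q * x"
    using assms by (intro add_mono mult_left_mono) auto
  also have "\<dots> = (p + q) * x" by (simp add: algebra_simps)
  finally show ?thesis using assms by (simp add: mult_le_cancel_left)
qed

text \<open>The right-hand side is bounded below along every monotone lattice path from \<open>(0, 0)\<close> to
  \<open>(p, q)\<close>; a uniformly random path visits each row and each column equally often on average.
  The last step of such a path is horizontal with probability \<open>p / (p + q)\<close>.\<close>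

lemma lattice_path_mean:
  fixes a b M :: "nat \<Rightarrow> real"
  assumes "\<And>i j. i \<le> p \<Longrightarrow> j \<le> q \<Longrightarrow> a i + b j \<le> M (i + j)"
  shows "(real p + real q + 1) * ((\<Sum>i\<le>p. a i) / (real p + 1) + (\<Sum>j\<le>q. b j) / (real q + 1))
    \<le> (\<Sum>n\<le>p + q. M n)"
  using assms
proof (induction "p + q" arbitrary: p q rule: less_induct)
  case less
  show ?case
  proof (cases "p = 0 \<or> q = 0")
    case True
    then show ?thesis
    proof
      assume p: "p = 0"
      have "(\<Sum>j\<le>q. a 0 + b j) \<le> (\<Sum>j\<le>q. M j)" using less.prems[of 0] p by (intro sum_mono) auto
      then show ?thesis by (simp add: p sum.distrib distrib_left add.commute)
    next
      assume q: "q = 0"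
      have "(\<Sum>i\<le>p. a i + b 0) \<le> (\<Sum>i\<le>p. M i)" using less.prems[of _ 0] q by (intro sum_mono) auto
      then show ?thesis by (simp add: q sum.distrib distrib_left add.commute)
    qed
  next
    case False
    then obtain p' q' where pq: "p = Suc p'" "q = Suc q'" by (metis not0_implies_Suc)
    let ?a = "sum a {..p'}" and ?b = "sum b {..q'}" and ?X = "\<Sum>n\<le>Suc (p' + q'). M n"
    let ?p = "real p' + 1" and ?q = "real q' + 1"
    \<comment> \<open>\<open>?X\<close> leaves out level p + q. Deleting the last step of a path
      leads to (p - 1, q) here and to (p, q - 1) in the next estimate; the weights \<open>?p\<close>
      = p and \<open>?q\<close> = q belong to these two kinds of last step.\<close>
    have 1: "(?p + ?q) * (?a / ?p + (?b + b q) / (?q + 1)) \<le> ?X"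
      using less.hyps[of p' q] less.prems pq by (simp add: algebra_simps)
    have 2: "(?p + ?q) * ((?a + a p) / (?p + 1) + ?b / ?q) \<le> ?X"
      using less.hyps[of p q'] less.prems pq by (simp add: algebra_simps)
    have "?p * (?a / ?p + (?b + b q) / (?q + 1)) + ?q * ((?a + a p) / (?p + 1) + ?b / ?q) \<le> ?X"
      using 1 2 by (intro weighted_average_le) auto
    moreover have "a p + b q \<le> M (p + q)" using less.prems[of p q] by simp
    moreover have "(\<Sum>n\<le>p + q. M n) = ?X + M (p + q)" by (simp add: pq)
    moreover have "(?p + ?q + 1) * ((?a + a p) / (?p + 1) + (?b + b q) / (?q + 1))
       = ?p * (?a / ?p + (?b + b q) / (?q + 1)) + ?q * ((?a + a p) / (?p + 1) + ?b / ?q) + (a p + b q)"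
    proof -
      have "(?p + ?q + 1) * ((?a + a p) / (?p + 1)) = ?a + a p + ?q * ((?a + a p) / (?p + 1))"
        by (simp add: field_simps)
      moreover have "(?p + ?q + 1) * ((?b + b q) / (?q + 1)) = ?b + b q + ?p * ((?b + b q) / (?q + 1))"
        by (simp add: field_simps)
      moreover have "?p * (?a / ?p) = ?a" "?q * (?b / ?q) = ?b" by auto
      ultimately show ?thesis by (simp only: distrib_left)
    qed
    ultimately show ?thesis by (simp add: pq algebra_simps)
  qed
qed

lemma sum_card_levels:
  fixes f :: "'a \<Rightarrow> real"
  assumes "finite X"
  shows "(\<Sum>n\<in>N. card {x \<in> X. f x = real n}) \<le> card X"
    and "(\<And>x. x \<in> X \<Longrightarrow> f x \<in> real ` N) \<Longrightarrow> finite N \<Longrightarrow> (\<Sum>n\<in>N. card {x \<in> X. f x = real n}) = card X"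
proof -
  have eq: "(\<Sum>n\<in>N. card {x \<in> X. f x = real n}) = card (\<Union>n\<in>N. {x \<in> X. f x = real n})" if "finite N"
    using assms that by (subst card_UN_disjoint) auto
  show "(\<Sum>n\<in>N. card {x \<in> X. f x = real n}) \<le> card X"
    using eq assms by (cases "finite N") (auto intro!: card_mono)
  assume "\<And>x. x \<in> X \<Longrightarrow> f x \<in> real ` N" and N: "finite N"
  then have "(\<Union>n\<in>N. {x \<in> X. f x = real n}) = X" by auto
  then show "(\<Sum>n\<in>N. card {x \<in> X. f x = real n}) = card X" using eq N by simp
qed

text \<open>Coordinate \<open>k\<close> has the values 0, 1, 2 on the three sums, which are
  therefore disjoint.\<close>

lemma card_three_layers:
  fixes A0 A1 B0 B1 :: "(real ^ 'n) set"
  assumes fin: "finite A0" "finite A1" "finite B0" "finite B1"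
    and f: "\<And>x. x \<in> A0 \<union> B0 \<Longrightarrow> x $ k = 0" "\<And>x. x \<in> A1 \<union> B1 \<Longrightarrow> x $ k = 1"
  shows "card (A0 + B0) + card ((A0 + B1) \<union> (A1 + B0)) + card (A1 + B1)
    \<le> card ((A0 \<union> A1) + (B0 \<union> B1))"
proof -
  let ?U = "A0 + B0" and ?V = "(A0 + B1) \<union> (A1 + B0)" and ?W = "A1 + B1"
  have U: "x $ k = 0" if "x \<in> ?U" for x using that f(1) by (auto elim!: set_plus_elim)
  have V: "x $ k = 1" if "x \<in> ?V" for x using that f by (auto elim!: set_plus_elim)
  have W: "x $ k = 2" if "x \<in> ?W" for x using that f(2) by (auto elim!: set_plus_elim)
  have finU: "finite ?U" "finite ?V" "finite ?W" using fin by (simp_all add: finite_set_plus)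
  have "x \<notin> ?V" if "x \<in> ?U" for x using U[OF that] V[of x] by linarith
  then have 1: "?U \<inter> ?V = {}" by blast
  have "x \<notin> ?W" if "x \<in> ?U \<union> ?V" for x using that U[of x] V[of x] W[of x]
    by (metis UnE one_neq_zero zero_neq_numeral one_eq_numeral_iff num.distinct(1))
  then have 2: "(?U \<union> ?V) \<inter> ?W = {}" by blast
  have "card ?U + card ?V + card ?W = card (?U \<union> ?V \<union> ?W)"
    using finU 1 2 by (simp only: card_Un_disjoint finite_UnI)
  also have "\<dots> \<le> card ((A0 \<union> A1) + (B0 \<union> B1))"
    using fin by (intro card_mono) (auto simp: finite_set_plus Un_set_plus set_plus_Un)
  finally show ?thesis .
qed

section \<open>Combs: decomposition into core and teeth\<close>

locale comb =
  fixes z c :: "'n::finite" and A :: "(real ^ 'n) set" and L :: nat and I :: "'n set"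
  assumes zc: "z \<noteq> c" and finite_A: "finite A" and I: "z \<notin> I" "c \<notin> I" and L: "L \<ge> 1"
    and shape: "\<And>x. x \<in> A \<Longrightarrow> \<exists>t. (\<exists>n<L. x = real n *\<^sub>R unit c + t *\<^sub>R unit z) \<or> (\<exists>k\<in>I. x = unit k + t *\<^sub>R unit z)"
    and core_mem: "\<And>n. n < L \<Longrightarrow> real n *\<^sub>R unit c \<in> A"
    and unit_mem: "\<And>k. k \<in> I \<Longrightarrow> unit k \<in> A"
begin

sublocale compression "unit z" "\<lambda>x. x $ z" by (rule compression_coordinate) simp

text \<open>The core with the teeth indexed by \<open>K\<close>, cut out by coordinates:
  \<open>part {}\<close> is the core and \<open>part (- {z, c})\<close> is \<open>A\<close>. The
  bounds below are proved by letting \<open>K\<close> grow.\<close>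

definition part :: "'n set \<Rightarrow> (real ^ 'n) set" where
  "part K = {x \<in> A. \<forall>k. k \<notin> K \<longrightarrow> k \<noteq> z \<longrightarrow> k \<noteq> c \<longrightarrow> x $ k = 0}"

text \<open>For \<open>k\<close> other than \<open>z\<close> and \<open>c\<close> this is the part
  of \<open>A\<close> on the line through \<open>unit k\<close>; at \<open>k = c\<close> it would
  concern the core instead.\<close>

definition tooth :: "'n \<Rightarrow> (real ^ 'n) set" where "tooth k = {x \<in> A. x $ k = 1}"

lemma finite_part [simp]: "finite (part K)" and finite_tooth [simp]: "finite (tooth k)"
  using finite_A by (simp_all add: part_def tooth_def)

lemma base_unit: "k \<noteq> z \<Longrightarrow> base (unit k) = unit k"
  by (rule base_eq_self) (simp add: axis_def)

lemma shape_cases: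
  assumes "x \<in> A"
  obtains (core) n where "n < L" "base x = real n *\<^sub>R unit c" "x $ c = real n"
      "\<And>k. k \<noteq> z \<Longrightarrow> k \<noteq> c \<Longrightarrow> x $ k = 0"
    | (tooth) k where "k \<in> I" "base x = unit k" "x $ k = 1" "\<And>j. j \<noteq> z \<Longrightarrow> j \<noteq> k \<Longrightarrow> x $ j = 0"
proof -
  obtain t where "(\<exists>n<L. x = real n *\<^sub>R unit c + t *\<^sub>R unit z) \<or> (\<exists>k\<in>I. x = unit k + t *\<^sub>R unit z)"
    using shape[OF assms] by blast
  then show thesis
  proof
    assume "\<exists>n<L. x = real n *\<^sub>R unit c + t *\<^sub>R unit z"
    then obtain n where n: "n < L" "x = real n *\<^sub>R unit c + t *\<^sub>R unit z" by blast
    have "base x = real n *\<^sub>R unit c" using base_unit[of c] zc n by simp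
    then show thesis using n zc by (intro core[of n]) (auto simp: axis_def)
  next
    assume "\<exists>k\<in>I. x = unit k + t *\<^sub>R unit z"
    then obtain k where k: "k \<in> I" "x = unit k + t *\<^sub>R unit z" by blast
    have "k \<noteq> z" using k I by auto
    then have "base x = unit k" using base_unit[of k] k by simp
    then show thesis using k \<open>k \<noteq> z\<close> by (intro tooth[of k]) (auto simp: axis_def)
  qed
qed

lemma base_tooth: 
  assumes "x \<in> tooth k" "k \<noteq> z" "k \<noteq> c" shows "base x = unit k" "k \<in> I"
proof -
  have x: "x \<in> A" "x $ k = 1" using assms by (auto simp: tooth_def)
  show "base x = unit k" using x(1)
    by (cases rule: shape_cases) (use x assms in \<open>force+\<close>)
  show "k \<in> I" using x(1)
    by (cases rule: shape_cases) (use x assms in \<open>force+\<close>)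
qed

lemma tooth_nonempty: "k \<in> I \<Longrightarrow> tooth k \<noteq> {}"
  using unit_mem by (force simp: tooth_def)

lemma tooth_empty: "k \<notin> I \<Longrightarrow> k \<noteq> z \<Longrightarrow> k \<noteq> c \<Longrightarrow> tooth k = {}"
  using base_tooth(2) by blast

lemma part_insert:
  assumes "k \<noteq> z" "k \<noteq> c" shows "part (insert k K) = part K \<union> tooth k"
proof (intro equalityI subsetI)
  fix x assume x: "x \<in> part (insert k K)"
  then have "x \<in> A" by (simp add: part_def)
  then show "x \<in> part K \<union> tooth k"
  proof (cases rule: shape_cases)
    case (core n)
    then show ?thesis using x by (auto simp: part_def)
  next
    case (tooth j)
    then show ?thesis using x by (cases "j = k") (auto simp: part_def tooth_def)
  qed
next
  fix x assume x: "x \<in> part K \<union> tooth k"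
  show "x \<in> part (insert k K)"
  proof (cases "x \<in> part K")
    case True then show ?thesis by (auto simp: part_def)
  next
    case False
    then have xt: "x \<in> A" "x $ k = 1" using x by (auto simp: tooth_def)
    from xt(1) show ?thesis
    proof (cases rule: shape_cases)
      case (core n)
      then show ?thesis using xt by (auto simp: part_def)
    next
      case (tooth j)
      then have "j = k" using xt assms by force
      then show ?thesis using xt tooth by (auto simp: part_def)
    qed
  qed
qed

lemma part_zero: "x \<in> part K \<Longrightarrow> k \<notin> K \<Longrightarrow> k \<noteq> z \<Longrightarrow> k \<noteq> c \<Longrightarrow> x $ k = 0"
  by (simp add: part_def)

lemma part_all: "part (- {z, c}) = A" by (auto simp: part_def)

lemma card_part_insert:
  assumes "k \<notin> K" "k \<noteq> z" "k \<noteq> c"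
  shows "card (part (insert k K)) = card (part K) + card (tooth k)"
proof -
  have "part K \<inter> tooth k = {}" using part_zero[of _ K k] assms by (force simp: tooth_def)
  then show ?thesis by (simp add: part_insert assms card_Un_disjoint)
qed

lemma base_part: "base ` part K = (\<lambda>n. real n *\<^sub>R unit c) ` {..<L} \<union> unit ` (I \<inter> K)"
proof (intro equalityI subsetI)
  fix u assume "u \<in> base ` part K"
  then obtain x where x: "x \<in> part K" "x \<in> A" "u = base x" by (auto simp: part_def)
  from x(2) show "u \<in> (\<lambda>n. real n *\<^sub>R unit c) ` {..<L} \<union> unit ` (I \<inter> K)"
  proof (cases rule: shape_cases)
    case (tooth k)
    then have "k \<in> K" using x part_zero[of x K k] I by force
    then show ?thesis using tooth x by auto
  qed (use x in auto)
next
  fix u assume "u \<in> (\<lambda>n. real n *\<^sub>R unit c) ` {..<L} \<union> unit ` (I \<inter> K)"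
  then consider n where "n < L" "u = real n *\<^sub>R unit c" | k where "k \<in> I" "k \<in> K" "u = unit k"
    by auto
  then show "u \<in> base ` part K"
  proof cases
    case 1
    then have "u \<in> part K" using core_mem by (auto simp: part_def axis_def)
    moreover have "base u = u" using 1 base_unit[of c] zc by simp
    ultimately show ?thesis by force
  next
    case 2
    then have "u \<in> part K" using unit_mem by (auto simp: part_def axis_def)
    moreover have "base u = u" using 2 base_unit[of k] I by force
    ultimately show ?thesis by force
  qed
qed

text \<open>Core lines and teeth have different base points since \<open>c \<notin> I\<close>. With
  \<open>K = - {z, c}\<close> this counts all lines and gives r_1 = L + |I| and r_2 = M +
  |J|.\<close>

lemma card_base_part: "card (base ` part K) = L + card (I \<inter> K)"
proof -
  have "card ((\<lambda>n. real n *\<^sub>R unit c :: real ^ 'n) ` {..<L}) = L"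
    by (subst card_image) (auto simp: inj_on_def vec_eq_iff axis_def)
  moreover have "card ((unit :: 'n \<Rightarrow> real ^ 'n) ` (I \<inter> K)) = card (I \<inter> K)"
    by (intro card_image) (auto simp: inj_on_def axis_eq_axis)
  moreover have "real n *\<^sub>R unit c \<noteq> (unit k :: real ^ 'n)" if "k \<in> I" for n k
  proof
    assume "real n *\<^sub>R unit c = (unit k :: real ^ 'n)"
    then have "(real n *\<^sub>R unit c :: real ^ 'n) $ k = unit k $ k" by simp
    then show False using that I by (auto simp: axis_def split: if_splits)
  qed
  ultimately show ?thesis
    unfolding base_part by (subst card_Un_disjoint) auto
qed

lemma core_level:
  assumes "x \<in> part {}" obtains n where "n < L" "base x = real n *\<^sub>R unit c" "x $ c = real n"
proof -
  have "x \<in> A" using assms by (simp add: part_def)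
  then show thesis
  proof (cases rule: shape_cases)
    case (core n) then show ?thesis using that by blast
  next
    case (tooth k)
    then show ?thesis using assms part_zero[of x "{}" k] I by force
  qed
qed

end

text \<open>\<open>balanced\<close> makes the coefficients of |A| and |B| agree while shared teeth
  are added. It will follow from stability, which transfers the last multiple of e_c from either set
  to the other.\<close>

locale comb_pair = A: comb z c A L I + B: comb z c B M J
  for z c :: "'n::finite" and A L I B M J +
  assumes cover: "I \<union> J = - {z, c}" and balanced: "I \<inter> J \<noteq> {} \<Longrightarrow> L = M"
begin

text \<open>Level i of one core and level j of the other lie on single lines, and their sum lies in
  level i + j: the situation of \<open>lattice_path_mean\<close> with p = L - 1 and q = M -
  1.\<close>

lemma core_bound:
  "(real L + real M - 1) * (card (A.part {}) / real L + card (B.part {}) / real M - 1)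
    \<le> card (A.part {} + B.part {})"
proof -
  let ?X = "A.part {}" and ?Y = "B.part {}"
  let ?S = "?X + ?Y"
  define a where "a i = real (card {x \<in> ?X. x $ c = real i})" for i
  define b where "b i = real (card {x \<in> ?Y. x $ c = real i})" for i
  \<comment> \<open>The added 1 absorbs the loss of 1 in the bound for a sum of two lines; over the
    L + M - 1 levels it becomes the -1 in the last factor of the claim.\<close>
  define m where "m i = real (card {x \<in> ?S. x $ c = real i}) + 1" for i
  obtain p q where pq: "L = Suc p" "M = Suc q" using A.L B.L by (metis not_one_le_zero not0_implies_Suc)
  have finS: "finite ?S" by (simp add: finite_set_plus)
  have "a i + b j \<le> m (i + j)" if ij: "i \<le> p" "j \<le> q" for i j
  proof -
    let ?P = "{x \<in> ?X. x $ c = real i}" and ?Q = "{x \<in> ?Y. x $ c = real j}"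
    have "card ?P + card ?Q \<le> card (?P + ?Q) + 1"
    proof (rule A.card_plus_line)
      have "real i *\<^sub>R unit c \<in> ?P" "real j *\<^sub>R unit c \<in> ?Q"
        using A.core_mem[of i] B.core_mem[of j] ij pq by (auto simp: A.part_def B.part_def axis_def)
      then show "?P \<noteq> {}" "?Q \<noteq> {}" by blast+
      show "A.base x = real i *\<^sub>R unit c" if "x \<in> ?P" for x
        using that A.core_level[of x] by auto
      show "A.base x = real j *\<^sub>R unit c" if "x \<in> ?Q" for x
        using that B.core_level[of x] by auto
    qed auto
    moreover have "card (?P + ?Q) \<le> card {x \<in> ?S. x $ c = real (i + j)}"
      using finS by (intro card_mono) (auto elim!: set_plus_elim)
    ultimately show ?thesis by (simp add: a_def b_def m_def)
  qed
  then have "(real p + real q + 1) * ((\<Sum>i\<le>p. a i) / (real p + 1) + (\<Sum>j\<le>q. b j) / (real q + 1))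
      \<le> (\<Sum>n\<le>p + q. m n)" by (rule lattice_path_mean)
  moreover have "(\<Sum>i\<le>p. a i) = card ?X"
    unfolding a_def of_nat_sum[symmetric]
    by (subst sum_card_levels(2)) (use pq in \<open>auto elim!: A.core_level\<close>)
  moreover have "(\<Sum>i\<le>q. b i) = card ?Y"
    unfolding b_def of_nat_sum[symmetric]
    by (subst sum_card_levels(2)) (use pq in \<open>auto elim!: B.core_level\<close>)
  moreover have "(\<Sum>n\<le>p + q. m n) \<le> real (card ?S) + (real p + real q + 1)"
    using sum_card_levels(1)[OF finS, of "\<lambda>x. x $ c" "{..p + q}"]
    unfolding m_def by (simp add: sum.distrib flip: of_nat_sum)
  ultimately show ?thesis by (simp add: pq algebra_simps)
qed

lemma card_part_plus_insert:
  assumes k: "k \<notin> K" "k \<noteq> z" "k \<noteq> c"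
  shows "card (A.part K + B.part K)
      + card ((A.part K + B.tooth k) \<union> (A.tooth k + B.part K)) + card (A.tooth k + B.tooth k)
    \<le> card (A.part (insert k K) + B.part (insert k K))"
  unfolding A.part_insert[OF k(2,3)] B.part_insert[OF k(2,3)]
proof (rule card_three_layers)
  show "x $ k = 0" if "x \<in> A.part K \<union> B.part K" for x
    using that A.part_zero[OF _ k] B.part_zero[OF _ k] by blast
  show "x $ k = 1" if "x \<in> A.tooth k \<union> B.tooth k" for x
    using that by (auto simp: A.tooth_def B.tooth_def)
qed simp_all

text \<open>Only \<open>A.part K + B.tooth k\<close> is counted in the middle layer: each of the L +
  |I \<inter> K| lines gains |B.tooth k| - 1 points.\<close>

lemma card_plus_B_tooth:
  assumes k: "k \<in> J"
  shows "card (A.part K) + (L + card (I \<inter> K)) * (card (B.tooth k) - 1)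
    \<le> card ((A.part K + B.tooth k) \<union> (A.tooth k + B.part K))"
proof -
  have k': "k \<noteq> z" "k \<noteq> c" using k B.I by auto
  have "card (A.part K) + card (A.base ` A.part K) * (card (B.tooth k) - 1)
      \<le> card (A.part K + B.tooth k)"
    using k k' by (intro A.card_plus_lines[of _ _ "unit k"]) (auto simp: B.tooth_nonempty B.base_tooth)
  also have "\<dots> \<le> card ((A.part K + B.tooth k) \<union> (A.tooth k + B.part K))"
    by (intro card_mono) (auto simp: finite_set_plus)
  finally show ?thesis by (simp add: A.card_base_part)
qed

lemma card_plus_A_tooth:
  assumes k: "k \<in> I"
  shows "card (B.part K) + (M + card (J \<inter> K)) * (card (A.tooth k) - 1)
    \<le> card ((A.part K + B.tooth k) \<union> (A.tooth k + B.part K))"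
proof -
  have k': "k \<noteq> z" "k \<noteq> c" using k A.I by auto
  \<comment> \<open>The projection depends on \<open>z\<close> alone, so \<open>A.base\<close> also
    separates the lines of \<open>B\<close>.\<close>
  have "card (B.part K) + card (A.base ` B.part K) * (card (A.tooth k) - 1)
      \<le> card (B.part K + A.tooth k)"
    using k k' by (intro A.card_plus_lines[of _ _ "unit k"]) (auto simp: A.tooth_nonempty A.base_tooth)
  also have "\<dots> \<le> card ((A.part K + B.tooth k) \<union> (A.tooth k + B.part K))"
    by (intro card_mono) (auto simp: finite_set_plus add.commute[of "B.part K"])
  finally show ?thesis by (simp add: B.card_base_part)
qed

text \<open>The shared coordinates have to be added before the others: a tooth in both sets only gains
  the mean of the two possible contributions, which suffices as long as no other teeth are present.\<close>

lemma shared_bound: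
  assumes "K \<subseteq> I \<inter> J"
  shows "((real L + real M - 1) / L + card K / 2) * card (A.part K)
      + ((real L + real M - 1) / M + card K / 2) * card (B.part K)
      - (real (card K) + 1) * (real (L + card I) + real (M + card J))
    \<le> card (A.part K + B.part K)"
proof -
  have "finite K" by simp
  then show ?thesis using assms
  proof (induction K rule: finite_induct)
    case empty
    have "(real L + real M - 1) \<le> real (L + card I) + real (M + card J)" by simp
    then show ?case using core_bound by (simp add: algebra_simps)
  next
    case (insert k K)
    have k: "k \<in> I" "k \<in> J" "k \<noteq> z" "k \<noteq> c" using insert.prems A.I by auto
    have LM: "M = L" using balanced insert.prems by auto
    have IK: "I \<inter> K = K" "J \<inter> K = K" using insert.prems by auto
    let ?a = "real (card (A.part K))" and ?b = "real (card (B.part K))" and ?s = "real (card K)"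
    let ?a' = "real (card (A.tooth k))" and ?b' = "real (card (B.tooth k))"
    let ?R = "real L + ?s" and ?E = "real (L + card I) + real (M + card J)"
    have pos: "card (A.tooth k) \<ge> 1" "card (B.tooth k) \<ge> 1"
      using A.tooth_nonempty B.tooth_nonempty k by (auto simp: Suc_le_eq card_gt_0_iff)
    let ?V = "real (card ((A.part K + B.tooth k) \<union> (A.tooth k + B.part K)))"
    have "real (card (A.part K) + (L + card K) * (card (B.tooth k) - 1)) \<le> ?V"
      using card_plus_B_tooth[OF k(2), of K] by (simp only: of_nat_le_iff IK)
    then have 1: "?a + ?R * (?b' - 1) \<le> ?V" using pos by (simp add: of_nat_diff)
    have "real (card (B.part K) + (M + card K) * (card (A.tooth k) - 1)) \<le> ?V"
      using card_plus_A_tooth[OF k(1), of K] by (simp only: of_nat_le_iff IK)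
    then have 2: "?b + ?R * (?a' - 1) \<le> ?V" using pos by (simp add: of_nat_diff LM)
    have "card (A.tooth k) + card (B.tooth k) \<le> card (A.tooth k + B.tooth k) + 1"
      using A.tooth_nonempty B.tooth_nonempty k A.base_tooth B.base_tooth
      by (intro A.card_plus_line[of _ _ "unit k" "unit k"]) auto
    then have 3: "?a' + ?b' - 1 \<le> real (card (A.tooth k + B.tooth k))" by linarith
    have 4: "real (card (A.part K + B.part K)) + ?V + real (card (A.tooth k + B.tooth k))
        \<le> real (card (A.part (insert k K) + B.part (insert k K)))"
      using card_part_plus_insert[OF insert.hyps(2) k(3,4)] by linarith
    define m where "m = (2 * real L - 1) / L + ?s / 2"
    have IH: "m * ?a + m * ?b - (?s + 1) * ?E \<le> real (card (A.part K + B.part K))"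
      using insert.IH insert.prems by (simp add: m_def LM)
    have L: "real L \<ge> 1" using A.L by simp
    \<comment> \<open>Integrality enters here: the product is negative between 1 and 2. Its sign is
      equivalent to m + 1/2 \<le> R/2 + 1, where R = L + |K| is the number of lines of either
      part.\<close>
    have "(real L - 1) * (real L - 2) \<ge> 0"
    proof (cases "L = 1")
      case False
      then have "real L \<ge> 2" using A.L by simp
      then show ?thesis by simp
    qed simp
    then have "m + 1/2 \<le> ?R / 2 + 1"
      using L by (simp add: m_def field_simps)
    then have 5: "(m + 1/2) * (?a' + ?b') \<le> (?R / 2 + 1) * (?a' + ?b')"
      by (intro mult_right_mono) auto
    have "card K \<le> card I" using IK(1) by (metis card_mono finite Int_lower1)
    then have 6: "?R + 1 \<le> ?E" using L LM by simp
    have "(m + 1/2) * (?a + ?a') + (m + 1/2) * (?b + ?b') - (?s + 2) * ?E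
       = (m * ?a + m * ?b - (?s + 1) * ?E) + (?a + ?b) / 2 + (m + 1/2) * (?a' + ?b') - ?E"
      by (simp add: algebra_simps)
    also have "\<dots> \<le> real (card (A.part K + B.part K)) + (?a + ?b) / 2 + (?R / 2 + 1) * (?a' + ?b') - (?R + 1)"
      using IH 5 6 by linarith
    \<comment> \<open>The middle layer obeys both \<open>1\<close> and \<open>2\<close>; their mean
      yields the gain 1/2 in both coefficients.\<close>
    also have "\<dots> = real (card (A.part K + B.part K))
        + ((?a + ?R * (?b' - 1)) + (?b + ?R * (?a' - 1))) / 2 + (?a' + ?b' - 1)"
      by (simp add: field_simps)
    also have "\<dots> \<le> real (card (A.part (insert k K) + B.part (insert k K)))"
    proof -
      have "c0 + (x + y) / 2 + u \<le> t" if "x \<le> V" "y \<le> V" "u \<le> W" "c0 + V + W \<le> t" for c0 x y u t V W :: real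
        using that by (simp add: field_simps)
      then show ?thesis using 1 2 3 4 by blast
    qed
    finally show ?case
      using insert.hyps k by (simp add: A.card_part_insert B.card_part_insert m_def LM algebra_simps add_divide_distrib)
  qed
qed

text \<open>After the shared teeth, a tooth of \<open>A\<close> alone contributes the current part
  of \<open>B\<close> once more, raising the coefficient of |B| by one. Its own points have to be
  counted with the current coefficient of |A|, which is possible because that coefficient is at most
  the number of lines in the part of \<open>B\<close>. Teeth of \<open>B\<close> alone are
  symmetric.\<close>

lemma comb_pair_bound:
  "((real L + real M - 1) / L + card (J - I) + card (I \<inter> J) / 2) * card A
      + ((real L + real M - 1) / M + card (I - J) + card (I \<inter> J) / 2) * card B
      - (real CARD('n) - 1) * (real (L + card I) + real (M + card J))
    \<le> card (A + B)"
proof -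
  let ?T = "I \<inter> J" and ?E = "real (L + card I) + real (M + card J)"
  define \<mu> where "\<mu> = (real L + real M - 1) / L + card ?T / 2"
  define \<nu> where "\<nu> = (real L + real M - 1) / M + card ?T / 2"
  \<comment> \<open>Without the terms in |I \<inter> J|, both inequalities say (L - 1)(M - 1) \<ge>
    0.\<close>
  have \<mu>: "\<mu> \<le> real M + card ?T" and \<nu>: "\<nu> \<le> real L + card ?T"
  proof -
    have "(real M - 1) * (real L - 1) \<ge> 0" using A.L B.L by simp
    then have "(real L + real M - 1) / L \<le> real M" "(real L + real M - 1) / M \<le> real L"
      using A.L B.L by (simp_all add: field_simps)
    then show "\<mu> \<le> real M + card ?T" "\<nu> \<le> real L + card ?T" unfolding \<mu>_def \<nu>_def by simp_all
  qed
  have "(\<mu> + card ((J - I) \<inter> K)) * card (A.part (?T \<union> K))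
      + (\<nu> + card ((I - J) \<inter> K)) * card (B.part (?T \<union> K))
      - (real (card ?T) + real (card K) + 1) * ?E
    \<le> card (A.part (?T \<union> K) + B.part (?T \<union> K))" if "K \<subseteq> - {z, c} - ?T" for K
  proof -
    have "finite K" by simp
    then show ?thesis using that
    proof (induction K rule: finite_induct)
      case empty
      then show ?case using shared_bound[of ?T] by (simp add: \<mu>_def \<nu>_def)
    next
      case (insert k K)
      let ?K = "?T \<union> K"
      have k: "k \<notin> ?K" "k \<noteq> z" "k \<noteq> c" using insert by auto
      have eq: "?T \<union> insert k K = insert k ?K" by simp
      let ?a = "real (card (A.part ?K))" and ?b = "real (card (B.part ?K))"
      let ?a' = "real (card (A.tooth k))" and ?b' = "real (card (B.tooth k))"
      let ?p = "real (card ((I - J) \<inter> K))" and ?q = "real (card ((J - I) \<inter> K))"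
      let ?V = "real (card ((A.part ?K + B.tooth k) \<union> (A.tooth k + B.part ?K)))"
      have IH: "(\<mu> + ?q) * ?a + (\<nu> + ?p) * ?b - (real (card ?T) + real (card K) + 1) * ?E
          \<le> real (card (A.part ?K + B.part ?K))" using insert by simp
      have step: "real (card (A.part ?K + B.part ?K)) + ?V
          \<le> real (card (A.part (insert k ?K) + B.part (insert k ?K)))"
        using card_part_plus_insert[OF k] by linarith
      have "k \<in> I \<union> J" using cover k by auto
      then consider "k \<in> I" "k \<notin> J" | "k \<in> J" "k \<notin> I" using k by auto
      then show ?case
      proof cases
        case 1
        have pos: "card (A.tooth k) \<ge> 1"
          using A.tooth_nonempty 1 by (auto simp: Suc_le_eq card_gt_0_iff)
        have cp: "card ((I - J) \<inter> insert k K) = card ((I - J) \<inter> K) + 1" "(J - I) \<inter> insert k K = (J - I) \<inter> K"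
          using 1 insert.hyps by (auto simp: Int_insert_right)
        define R where "R = M + card (J \<inter> ?K)"
        have "real (card (B.part ?K) + R * (card (A.tooth k) - 1)) \<le> ?V"
          using card_plus_A_tooth[OF 1(1), of ?K] by (simp only: of_nat_le_iff R_def)
        then have "?b + real R * (?a' - 1) \<le> ?V" using pos by (simp add: of_nat_diff)
        then have V: "?b + real R * ?a' - real R \<le> ?V" by (simp add: right_diff_distrib)
        \<comment> \<open>\<open>R\<close> counts the lines of \<open>B.part ?K\<close>; a tooth of
          \<open>B\<close> alone raises it by one, just as it raises the coefficient of |A|.\<close>
        have "card (J \<inter> ?K) = card ?T + card ((J - I) \<inter> K)"
        proof -
          have "J \<inter> ?K = ?T \<union> (J - I) \<inter> K" using insert.prems by auto
          then show ?thesis by (simp add: card_Un_disjoint Int_Diff Diff_Int_distrib2 disjoint_iff)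
        qed
        then have "\<mu> + ?q \<le> real R" using \<mu> by (simp add: R_def)
        then have "(\<mu> + ?q) * ?a' \<le> real R * ?a'" by (rule mult_right_mono) simp
        moreover have "real R \<le> ?E"
        proof -
          have "card (J \<inter> ?K) \<le> card J" by (intro card_mono) auto
          then show ?thesis by (simp add: R_def)
        qed
        moreover have "(\<mu> + ?q) * (?a + ?a') + (\<nu> + (?p + 1)) * ?b - (real (card ?T) + (real (card K) + 1) + 1) * ?E
          = ((\<mu> + ?q) * ?a + (\<nu> + ?p) * ?b - (real (card ?T) + real (card K) + 1) * ?E) + (\<mu> + ?q) * ?a' + ?b - ?E"
          by (simp add: algebra_simps)
        ultimately have "(\<mu> + ?q) * (?a + ?a') + (\<nu> + (?p + 1)) * ?b - (real (card ?T) + (real (card K) + 1) + 1) * ?E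
          \<le> real (card (A.part (insert k ?K) + B.part (insert k ?K)))"
          using IH step V by linarith
        moreover have "B.tooth k = {}" using 1 k by (intro B.tooth_empty)
        ultimately show ?thesis
          unfolding eq cp A.card_part_insert[OF k] B.card_part_insert[OF k] card_insert_disjoint[OF insert.hyps]
          by (simp add: add.commute add.left_commute)
      next
        case 2
        have pos: "card (B.tooth k) \<ge> 1"
          using B.tooth_nonempty 2 by (auto simp: Suc_le_eq card_gt_0_iff)
        have cp: "card ((J - I) \<inter> insert k K) = card ((J - I) \<inter> K) + 1" "(I - J) \<inter> insert k K = (I - J) \<inter> K"
          using 2 insert.hyps by (auto simp: Int_insert_right)
        define R where "R = L + card (I \<inter> ?K)"
        have "real (card (A.part ?K) + R * (card (B.tooth k) - 1)) \<le> ?V"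
          using card_plus_B_tooth[OF 2(1), of ?K] by (simp only: of_nat_le_iff R_def)
        then have "?a + real R * (?b' - 1) \<le> ?V" using pos by (simp add: of_nat_diff)
        then have V: "?a + real R * ?b' - real R \<le> ?V" by (simp add: right_diff_distrib)
        have "card (I \<inter> ?K) = card ?T + card ((I - J) \<inter> K)"
        proof -
          have "I \<inter> ?K = ?T \<union> (I - J) \<inter> K" using insert.prems by auto
          then show ?thesis by (simp add: card_Un_disjoint Int_Diff Diff_Int_distrib2 disjoint_iff)
        qed
        then have "\<nu> + ?p \<le> real R" using \<nu> by (simp add: R_def)
        then have "(\<nu> + ?p) * ?b' \<le> real R * ?b'" by (rule mult_right_mono) simp
        moreover have "real R \<le> ?E"
        proof -
          have "card (I \<inter> ?K) \<le> card I" by (intro card_mono) auto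
          then show ?thesis by (simp add: R_def)
        qed
        moreover have "(\<mu> + (?q + 1)) * ?a + (\<nu> + ?p) * (?b + ?b') - (real (card ?T) + (real (card K) + 1) + 1) * ?E
          = ((\<mu> + ?q) * ?a + (\<nu> + ?p) * ?b - (real (card ?T) + real (card K) + 1) * ?E) + (\<nu> + ?p) * ?b' + ?a - ?E"
          by (simp add: algebra_simps)
        ultimately have "(\<mu> + (?q + 1)) * ?a + (\<nu> + ?p) * (?b + ?b') - (real (card ?T) + (real (card K) + 1) + 1) * ?E
          \<le> real (card (A.part (insert k ?K) + B.part (insert k ?K)))"
          using IH step V by linarith
        moreover have "A.tooth k = {}" using 2 k by (intro A.tooth_empty)
        ultimately show ?thesis
          unfolding eq cp A.card_part_insert[OF k] B.card_part_insert[OF k] card_insert_disjoint[OF insert.hyps]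
          by (simp add: add.commute add.left_commute)
      qed
    qed
  qed
  from this[of "- {z, c} - ?T"]
  have main: "(\<mu> + card ((J - I) \<inter> (- {z, c} - ?T))) * card A
      + (\<nu> + card ((I - J) \<inter> (- {z, c} - ?T))) * card B
      - (real (card ?T) + real (card (- {z, c} - ?T)) + 1) * ?E
    \<le> card (A + B)" (is "?lhs \<le> _")
  proof -
    have "?T \<union> (- {z, c} - ?T) = - {z, c}" using A.I by auto
    then show ?thesis using \<open>- {z, c} - ?T \<subseteq> - {z, c} - ?T \<Longrightarrow> _\<close> by (simp add: A.part_all B.part_all)
  qed
  have "(J - I) \<inter> (- {z, c} - ?T) = J - I" "(I - J) \<inter> (- {z, c} - ?T) = I - J"
    using A.I B.I by auto
  \<comment> \<open>One unit of error for the core and one for each of the CARD('n) - 2 coordinates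
    besides z and c.\<close>
  moreover have "real (card ?T) + real (card (- {z, c} - ?T)) + 1 = real CARD('n) - 1"
  proof -
    have "card ?T + card (- {z, c} - ?T) = card (?T \<union> (- {z, c} - ?T))"
      by (subst card_Un_disjoint) auto
    also have "?T \<union> (- {z, c} - ?T) = UNIV - {z, c}" using A.I by auto
    also have "card (UNIV - {z, c}) = CARD('n) - 2" using A.zc by (subst card_Diff_subset) auto
    finally have "card ?T + card (- {z, c} - ?T) = CARD('n) - 2" .
    moreover have "CARD('n) \<ge> card {z, c}" by (intro card_mono) auto
    ultimately show ?thesis using A.zc by simp
  qed
  ultimately show ?thesis using main unfolding \<mu>_def \<nu>_def by (simp only: ac_simps)
qed

end

section \<open>Structure of stable pairs\<close>

text \<open>Descend from \<open>x\<close> to \<open>y\<close> by unit steps: natural coordinates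
  leave room for a full step wherever \<open>y\<close> is strictly smaller.\<close>

lemma down_closed_mem:
  fixes x y :: "real ^ 'n"
  assumes nat: "\<And>x i. x \<in> A \<Longrightarrow> x $ i \<in> \<nat>"
    and down: "\<And>x k. x \<in> A \<Longrightarrow> x $ k \<ge> 1 \<Longrightarrow> x - unit k \<in> A"
    and "x \<in> A" "\<And>i. y $ i \<in> \<nat>" "\<And>i. y $ i \<le> x $ i"
  shows "y \<in> A"
  using assms(3,5)
proof (induction "nat \<lfloor>\<Sum>i\<in>UNIV. x $ i - y $ i\<rfloor>" arbitrary: x rule: less_induct)
  case less
  show ?case
  proof (cases "x = y")
    case True
    then show ?thesis using less.prems by simp
  next
    case False
    then obtain k where k: "y $ k < x $ k" using less.prems(2) by (metis vec_eq_iff order_le_less)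
    obtain n m where "x $ k = real n" "y $ k = real m" using nat[OF less.prems(1)] assms(4) Nats_cases by metis
    then have k1: "y $ k + 1 \<le> x $ k" "x $ k \<ge> 1" using k by auto
    let ?x = "x - unit k"
    have "(\<Sum>i\<in>UNIV. ?x $ i - y $ i) = (\<Sum>i\<in>UNIV. (x $ i - y $ i) - (if i = k then 1 else 0))"
      by (intro sum.cong) (auto simp: axis_def)
    also have "\<dots> = (\<Sum>i\<in>UNIV. x $ i - y $ i) - 1" by (subst sum_subtractf) simp
    finally have eq: "(\<Sum>i\<in>UNIV. ?x $ i - y $ i) = (\<Sum>i\<in>UNIV. x $ i - y $ i) - 1" .
    have le: "y $ i \<le> ?x $ i" for i using less.prems(2)[of i] k1 by (auto simp: axis_def)
    then have "0 \<le> (\<Sum>i\<in>UNIV. ?x $ i - y $ i)" by (intro sum_nonneg) simp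
    then have "nat \<lfloor>\<Sum>i\<in>UNIV. ?x $ i - y $ i\<rfloor> < nat \<lfloor>\<Sum>i\<in>UNIV. x $ i - y $ i\<rfloor>"
      unfolding eq by linarith
    then show ?thesis using less.hyps[of ?x] down[OF less.prems(1) k1(2)] le by blast
  qed
qed

text \<open>A point off the core that exceeds \<open>unit k\<close> in some coordinate
  \<open>j \<noteq> z\<close> dominates \<open>unit k + unit j\<close>. Trading
  \<open>unit k\<close> for m copies of \<open>unit c\<close> leaves \<open>unit j\<close> plus m
  copies of \<open>unit c\<close>. For j = c this is the excluded multiple m + 1; otherwise
  \<open>unit j + unit c\<close> lies in \<open>A\<close>, and trading \<open>unit j\<close>
  produces that multiple.\<close>

lemma stable_comb:
  fixes A :: "(real ^ 'n) set"
  assumes zc: "z \<noteq> c" and fin: "finite A"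
    and nat: "\<And>x i. x \<in> A \<Longrightarrow> x $ i \<in> \<nat>"
    and down: "\<And>x k. x \<in> A \<Longrightarrow> x $ k \<ge> 1 \<Longrightarrow> x - unit k \<in> A"
    and c: "unit c \<in> A" and m: "real m *\<^sub>R unit c \<in> A" "real (m + 1) *\<^sub>R unit c \<notin> A"
    and shift: "\<And>x k. k \<noteq> z \<Longrightarrow> k \<noteq> c \<Longrightarrow> unit k \<in> A \<Longrightarrow> x \<in> A \<Longrightarrow> x $ k \<ge> 1
      \<Longrightarrow> x - unit k + real m *\<^sub>R unit c \<in> A"
  shows "comb z c A (m + 1) {k. k \<noteq> z \<and> k \<noteq> c \<and> unit k \<in> A}"
proof
  have memI: "y \<in> A" if "x \<in> A" "\<And>i. y $ i \<in> \<nat>" "\<And>i. y $ i \<le> x $ i" for x y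
    using down_closed_mem[OF nat down that] by blast
  have m1: "m \<ge> 1" using m(2) c by (cases m) auto
  have ge1: "x $ i \<ge> 1" if "x \<in> A" "x $ i \<noteq> 0" for x i
    using nat[OF that(1), of i] that(2) by (auto elim!: Nats_cases)
  have nonneg: "x $ i \<ge> 0" if "x \<in> A" for x i
    using nat[OF that, of i] by (auto elim!: Nats_cases)
  show "n < m + 1 \<Longrightarrow> real n *\<^sub>R unit c \<in> A" for n
    by (rule memI[OF m(1)]) (auto simp: axis_def)
  fix x assume x: "x \<in> A"
  show "\<exists>t. (\<exists>n<m + 1. x = real n *\<^sub>R unit c + t *\<^sub>R unit z) \<or>
      (\<exists>k\<in>{k. k \<noteq> z \<and> k \<noteq> c \<and> unit k \<in> A}. x = unit k + t *\<^sub>R unit z)"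
  proof (cases "\<forall>k. k \<noteq> z \<longrightarrow> k \<noteq> c \<longrightarrow> x $ k = 0")
    case True
    obtain n where n: "x $ c = real n" using nat[OF x] Nats_cases by metis
    have "n < m + 1"
    proof (rule ccontr)
      assume "\<not> n < m + 1"
      then have "real (m + 1) *\<^sub>R unit c \<in> A"
        using n nonneg[OF x] by (intro memI[OF x]) (auto simp: axis_def simp flip: of_nat_Suc)
      then show False using m(2) by simp
    qed
    moreover have "x = real n *\<^sub>R unit c + (x $ z) *\<^sub>R unit z"
      using True n zc by (auto simp: vec_eq_iff axis_def)
    ultimately show ?thesis by blast
  next
    case False
    then obtain k where k: "k \<noteq> z" "k \<noteq> c" "x $ k \<noteq> 0" by blast
    have uk: "unit k \<in> A"
      using ge1[OF x k(3)] nonneg[OF x] by (intro memI[OF x]) (auto simp: axis_def)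
    have "x = unit k + (x $ z) *\<^sub>R unit z"
    proof (rule ccontr)
      assume "x \<noteq> unit k + (x $ z) *\<^sub>R unit z"
      then obtain j where j': "x $ j \<noteq> (unit k + (x $ z) *\<^sub>R unit z) $ j" by (auto simp: vec_eq_iff)
      then have j: "j \<noteq> z" "x $ j \<noteq> unit k $ j" using k(1) by (auto simp: axis_def split: if_splits)
      have uj: "unit j + unit c \<notin> A" if "j \<noteq> z" "j \<noteq> c" for j
      proof
        assume a: "unit j + unit c \<in> A"
        have "unit j \<in> A" by (rule memI[OF a]) (auto simp: axis_def)
        then have "unit j + unit c - unit j + real m *\<^sub>R unit c \<in> A"
          using a that by (intro shift) (auto simp: axis_def)
        moreover have "unit j + unit c - unit j + real m *\<^sub>R unit c = real (m + 1) *\<^sub>R unit c"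
          by (simp add: algebra_simps)
        ultimately show False using m(2) by metis
      qed
      have "unit k + unit j \<in> A"
      proof (rule memI[OF x])
        fix i
        show "(unit k + unit j) $ i \<in> \<nat>" by (auto simp: axis_def)
        \<comment> \<open>The case \<open>j = k\<close> is allowed: a natural coordinate other than
          0 and 1 is at least 2.\<close>
        have "x $ k \<ge> 2" if "j = k"
        proof -
          obtain n where "x $ k = real n" using nat[OF x] Nats_cases by metis
          then show ?thesis using j that ge1[OF x k(3)] by (auto simp: axis_def)
        qed
        moreover have "x $ j \<ge> 1" using j ge1[OF x, of j] ge1[OF x k(3)] by (auto simp: axis_def split: if_splits)
        ultimately show "(unit k + unit j) $ i \<le> x $ i"
          using nonneg[OF x, of i] ge1[OF x k(3)] by (auto simp: axis_def)
      qed
      then have "unit k + unit j - unit k + real m *\<^sub>R unit c \<in> A"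
        using k uk by (intro shift) (auto simp: axis_def)
      then have a: "unit j + real m *\<^sub>R unit c \<in> A" by simp
      have "unit j + unit c \<in> A" if "j \<noteq> c"
        by (rule memI[OF a]) (use m1 that in \<open>auto simp: axis_def\<close>)
      moreover have "real (m + 1) *\<^sub>R unit c \<in> A" if "j = c"
        using a that by (simp add: algebra_simps)
      ultimately show False using uj[OF j(1)] m(2) by blast
    qed
    then show ?thesis using k uk by blast
  qed
qed (use zc fin in auto)

text \<open>The bound \<open>m < card A\<close> lets weights that depend only on |A| and |B|
  dominate every multiple that occurs.\<close>

lemma ex_last_multiple:
  fixes A :: "(real ^ 'n) set"
  assumes fin: "finite A" and "0 \<in> A" and down: "\<And>x. x \<in> A \<Longrightarrow> x $ c \<ge> 1 \<Longrightarrow> x - unit c \<in> A"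
  obtains m where "real m *\<^sub>R unit c \<in> A" "real (m + 1) *\<^sub>R unit c \<notin> A" "m < card A"
    "\<And>n. real n *\<^sub>R unit c \<in> A \<Longrightarrow> n \<le> m"
proof -
  let ?N = "{n::nat. real n *\<^sub>R unit c \<in> A}"
  have inj: "inj (\<lambda>n::nat. real n *\<^sub>R unit c :: real ^ 'n)"
    by (auto simp: inj_on_def vec_eq_iff axis_def)
  have finN: "finite ?N" using finite_vimageI[OF fin inj] by (simp add: vimage_def)
  have "0 \<in> ?N" using assms by simp
  have step: "n \<in> ?N" if "Suc n \<in> ?N" for n
    using down[of "real (Suc n) *\<^sub>R unit c"] that by (simp add: algebra_simps)
  define m where "m = Max ?N"
  have m: "m \<in> ?N" unfolding m_def using finN \<open>0 \<in> ?N\<close> by (intro Max_in) blast+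
  have max: "n \<le> m" if "n \<in> ?N" for n unfolding m_def using finN that by simp
  have "m - i \<in> ?N" for i
  proof (induction i)
    case (Suc i)
    then show ?case
    proof (cases "m - i")
      case 0 then show ?thesis using Suc by (metis diff_Suc_eq_diff_pred diff_commute diff_0_eq_0 Suc_eq_plus1 diff_diff_left)
    next
      case (Suc j)
      then have "m - Suc i = j" by simp
      then show ?thesis using step[of j] Suc Suc.IH by simp
    qed
  qed (use m in simp)
  then have "{..m} \<subseteq> ?N" by (metis atMost_iff diff_diff_cancel subsetI)
  then have "card ((\<lambda>n. real n *\<^sub>R unit c :: real ^ 'n) ` {..m}) \<le> card A"
    using fin by (intro card_mono) auto
  moreover have "card ((\<lambda>n. real n *\<^sub>R unit c :: real ^ 'n) ` {..m}) = m + 1"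
    using inj by (subst card_image) (auto intro: inj_on_subset)
  moreover have "real (m + 1) *\<^sub>R unit c \<notin> A" using max[of "m + 1"] by auto
  ultimately show thesis using m max by (intro that[of m]) auto
qed

lemma squash_fixed_mem:
  assumes "w $ k = 1" "finite A" "squash k w A = A" "x \<in> A" "x $ k \<ge> 1"
  shows "x - w \<in> A"
proof -
  interpret compression w "\<lambda>x. x $ k" by (rule compression_coordinate) fact
  show ?thesis using assms compress_fixed_diff_mem by blast
qed

text \<open>For \<open>w = unit k\<close> the second point required on the line is 0, so every axis
  other than z is admissible; z itself is covered by \<open>stacked\<close>.\<close>

lemma minimal_lattice_pair_down:
  fixes A B :: "(real ^ 'n) set" and wt :: "'n \<Rightarrow> nat"
  assumes P: "lattice_pair z S \<sigma> a b r s d A B"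
    and wt: "\<And>i. i \<noteq> z \<Longrightarrow> wt i > 0"
    and min: "squash_stable z S wt A B"
  shows "\<And>x k. x \<in> A \<Longrightarrow> x $ k \<ge> 1 \<Longrightarrow> x - unit k \<in> A"
    and "\<And>x k. x \<in> B \<Longrightarrow> x $ k \<ge> 1 \<Longrightarrow> x - unit k \<in> B"
proof -
  have fin: "finite A" "finite B" using P by (auto simp: lattice_pair_def stacked_def)
  have st: "squash k (unit k) A = A \<and> squash k (unit k) B = B" if "k \<noteq> z" for k
  proof (rule min[unfolded squash_stable_def, rule_format])
    have "(\<Sum>i\<in>UNIV. real (wt i) * unit k $ i) = real (wt k)"
      by (simp add: axis_def if_distrib sum.delta cong: if_cong)
    then show "0 < (\<Sum>i\<in>UNIV. real (wt i) * unit k $ i)" using wt[OF that] by simp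
    show "unit k \<in> A \<and> unit k - unit k \<in> A \<or> unit k \<in> B \<and> unit k - unit k \<in> B"
      using P that by (auto simp: lattice_pair_def)
  qed (use that in \<open>auto simp: axis_def\<close>)
  show "x - unit k \<in> A" if "x \<in> A" "x $ k \<ge> 1" for x k
  proof (cases "k = z")
    case True then show ?thesis using P that by (auto simp: lattice_pair_def stacked_def)
  next
    case False then show ?thesis using st[OF False] fin that by (intro squash_fixed_mem) auto
  qed
  show "x - unit k \<in> B" if "x \<in> B" "x $ k \<ge> 1" for x k
  proof (cases "k = z")
    case True then show ?thesis using P that by (auto simp: lattice_pair_def stacked_def)
  next
    case False then show ?thesis using st[OF False] fin that by (intro squash_fixed_mem) auto
  qed
qed

lemma lattice_pair_to_comb_pair:
  fixes A0 B0 :: "(real ^ 'n) set"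
  assumes P0: "lattice_pair z {c} \<sigma> a b r s d A0 B0" and zc: "z \<noteq> c"
  obtains A B L M I J where "lattice_pair z {c} \<sigma> a b r s d A B" "comb_pair z c A L I B M J"
    "\<And>x k. x \<in> A \<Longrightarrow> x $ k \<ge> 1 \<Longrightarrow> x - unit k \<in> A" "\<And>x k. x \<in> B \<Longrightarrow> x $ k \<ge> 1 \<Longrightarrow> x - unit k \<in> B"
proof -
  \<comment> \<open>Admissible directions have no z-component. The weight a + b + 1 exceeds every
    relevant multiple n of the weight of e_c, so e_k - n e_c has positive weight.\<close>
  define wt where "wt i = (if i = z then 0 else if i = c then 1 else a + b + 1)" for i
  obtain A B where P: "lattice_pair z {c} \<sigma> a b r s d A B"
    and min: "squash_stable z {c} wt A B"
    using minimal_lattice_pair[OF P0, of wt] by blast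
  have wtpos: "\<And>i. i \<noteq> z \<Longrightarrow> wt i > 0" by (simp add: wt_def)
  note down = minimal_lattice_pair_down[OF P wtpos min]
  have fin: "finite A" "finite B" and cards: "card A = a" "card B = b"
    and c: "unit c \<in> A" "unit c \<in> B" and zero: "0 \<in> A" "0 \<in> B"
    and nat: "\<And>x i. x \<in> A \<Longrightarrow> x $ i \<in> \<nat>" "\<And>x i. x \<in> B \<Longrightarrow> x $ i \<in> \<nat>"
    and cover: "\<And>i. i \<noteq> z \<Longrightarrow> unit i \<in> A \<or> unit i \<in> B"
    using P by (auto simp: lattice_pair_def stacked_def)
  obtain m where m: "real m *\<^sub>R unit c \<in> A" "real (m + 1) *\<^sub>R unit c \<notin> A" "m < card A"
      "\<And>n. real n *\<^sub>R unit c \<in> A \<Longrightarrow> n \<le> m"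
    using ex_last_multiple[OF fin(1) zero(1) down(1)] by metis
  obtain m' where m': "real m' *\<^sub>R unit c \<in> B" "real (m' + 1) *\<^sub>R unit c \<notin> B" "m' < card B"
      "\<And>n. real n *\<^sub>R unit c \<in> B \<Longrightarrow> n \<le> m'"
    using ex_last_multiple[OF fin(2) zero(2) down(2)] by metis
  \<comment> \<open>Admissibility needs \<open>unit k\<close> and n e_c together in one of the sets,
    but the resulting stability holds for both.\<close>
  have shift: "(x \<in> A \<longrightarrow> x - unit k + real n *\<^sub>R unit c \<in> A) \<and> (x \<in> B \<longrightarrow> x - unit k + real n *\<^sub>R unit c \<in> B)"
    if k: "k \<noteq> z" "k \<noteq> c" and n: "n \<le> a + b"
      "unit k \<in> A \<and> real n *\<^sub>R unit c \<in> A \<or> unit k \<in> B \<and> real n *\<^sub>R unit c \<in> B" and x: "x $ k \<ge> 1"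
    for k n x
  proof -
    let ?w = "unit k - real n *\<^sub>R unit c :: real ^ 'n"
    have st: "squash k ?w A = A \<and> squash k ?w B = B"
    proof (rule min[unfolded squash_stable_def, rule_format])
      have "(\<Sum>i\<in>UNIV. real (wt i) * ?w $ i)
          = (\<Sum>i\<in>UNIV. (if i = k then real (wt k) else 0) - (if i = c then real n * real (wt c) else 0))"
        using k by (intro sum.cong) (auto simp: axis_def)
      also have "\<dots> = real (wt k) - real n * real (wt c)" by (subst sum_subtractf) simp
      finally show "0 < (\<Sum>i\<in>UNIV. real (wt i) * ?w $ i)" using k zc n(1) by (simp add: wt_def)
      show "unit k \<in> A \<and> unit k - ?w \<in> A \<or> unit k \<in> B \<and> unit k - ?w \<in> B" using n(2) by simp
    qed (use k zc in \<open>auto simp: axis_def\<close>)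
    have w: "?w $ k = 1" using k by (simp add: axis_def)
    have "x - ?w = x - unit k + real n *\<^sub>R unit c" by simp
    then show ?thesis using squash_fixed_mem[OF w fin(1)] squash_fixed_mem[OF w fin(2)] st x by metis
  qed
  define I where "I = {k. k \<noteq> z \<and> k \<noteq> c \<and> unit k \<in> A}"
  define J where "J = {k. k \<noteq> z \<and> k \<noteq> c \<and> unit k \<in> B}"
  have "comb z c A (m + 1) I" unfolding I_def
  proof (rule stable_comb[OF zc fin(1) nat(1) down(1) c(1) m(1,2)])
    show "x - unit k + real m *\<^sub>R unit c \<in> A"
      if "k \<noteq> z" "k \<noteq> c" "unit k \<in> A" "x \<in> A" "x $ k \<ge> 1" for x k
      using shift[OF that(1,2), of m x] that m cards by auto
  qed
  moreover have "comb z c B (m' + 1) J" unfolding J_def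
  proof (rule stable_comb[OF zc fin(2) nat(2) down(2) c(2) m'(1,2)])
    show "x - unit k + real m' *\<^sub>R unit c \<in> B"
      if "k \<noteq> z" "k \<noteq> c" "unit k \<in> B" "x \<in> B" "x $ k \<ge> 1" for x k
      using shift[OF that(1,2), of m' x] that m' cards by auto
  qed
  moreover have "I \<union> J = - {z, c}" using cover by (auto simp: I_def J_def)
  moreover have "m + 1 = m' + 1" if "I \<inter> J \<noteq> {}"
  proof -
    obtain k where "k \<in> I" "k \<in> J" using \<open>I \<inter> J \<noteq> {}\<close> by blast
    then have k: "k \<noteq> z" "k \<noteq> c" "unit k \<in> A" "unit k \<in> B" by (simp_all add: I_def J_def)
    \<comment> \<open>Shifting the common point \<open>unit k\<close> lands on the multiple itself,
      now in the other set.\<close>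
    have "real m *\<^sub>R unit c \<in> B" using shift[OF k(1,2), of m "unit k"] k m cards by auto
    moreover have "real m' *\<^sub>R unit c \<in> A" using shift[OF k(1,2), of m' "unit k"] k m' cards by auto
    ultimately show ?thesis using m(4)[of m'] m'(4)[of m] by simp
  qed
  ultimately have "comb_pair z c A (m + 1) I B (m' + 1) J"
    by (simp add: comb_pair_def comb_pair_axioms_def)
  then show thesis using P down by (intro that) auto
qed

section \<open>Line counts of down-closed pairs and the case of complementary supports\<close>

lemma base_image_eq_level:
  fixes A :: "(real ^ 'n) set"
  assumes nat: "\<And>x i. x \<in> A \<Longrightarrow> x $ i \<in> \<nat>"
    and down: "\<And>x k. x \<in> A \<Longrightarrow> x $ k \<ge> 1 \<Longrightarrow> x - unit k \<in> A"
  shows "(\<lambda>x. x - x $ z *\<^sub>R unit z) ` A = {x \<in> A. x $ z = 0}"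
proof (intro equalityI subsetI)
  fix u assume "u \<in> (\<lambda>x. x - x $ z *\<^sub>R unit z) ` A"
  then obtain x where x: "x \<in> A" "u = x - x $ z *\<^sub>R unit z" by blast
  have nonneg: "x $ z \<ge> 0" using nat[OF x(1), of z] by (auto elim!: Nats_cases)
  have "u \<in> A"
    by (rule down_closed_mem[OF nat down x(1)]) (use x nat nonneg in \<open>auto simp: axis_def\<close>)
  then show "u \<in> {x \<in> A. x $ z = 0}" using x by simp
qed force

lemma lattice_pair_base_card:
  fixes A B :: "(real ^ 'n) set"
  assumes P: "lattice_pair z S \<sigma> a b r s d A B"
    and down: "\<And>x k. x \<in> A \<Longrightarrow> x $ k \<ge> 1 \<Longrightarrow> x - unit k \<in> A" "\<And>x k. x \<in> B \<Longrightarrow> x $ k \<ge> 1 \<Longrightarrow> x - unit k \<in> B"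
  shows "card ((\<lambda>x. x - x $ z *\<^sub>R unit z) ` A) = r" "card ((\<lambda>x. x - x $ z *\<^sub>R unit z) ` B) = s"
  using P base_image_eq_level[of A z, OF _ down(1)] base_image_eq_level[of B z, OF _ down(2)]
  unfolding lattice_pair_def stacked_def by auto

text \<open>Off z, every coordinate vanishes on all of \<open>A\<close> or on all of
  \<open>B\<close>, so a sum determines the line of its summand in \<open>B\<close>. Hence the sums
  of \<open>A\<close> with the s lines of \<open>B\<close> are disjoint, and a line with n points
  contributes at least a + r(n - 1).\<close>

lemma disjoint_support_bound:
  fixes A B :: "(real ^ 'n) set"
  assumes P: "lattice_pair z S \<sigma> a b r s d A B"
    and down: "\<And>x k. x \<in> A \<Longrightarrow> x $ k \<ge> 1 \<Longrightarrow> x - unit k \<in> A" "\<And>x k. x \<in> B \<Longrightarrow> x $ k \<ge> 1 \<Longrightarrow> x - unit k \<in> B"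
    and disj: "\<And>i. i \<noteq> z \<Longrightarrow> unit i \<in> A \<Longrightarrow> unit i \<notin> B"
  shows "real s * real a + real r * (real b - real s) \<le> real \<sigma>"
proof -
  interpret compression "unit z" "\<lambda>x. x $ z" by (rule compression_coordinate) simp
  have fin: "finite A" "finite B" and cards: "card A = a" "card B = b"
    and nat: "\<And>x i. x \<in> A \<Longrightarrow> x $ i \<in> \<nat>" "\<And>x i. x \<in> B \<Longrightarrow> x $ i \<in> \<nat>"
    and \<sigma>: "card (A + B) \<le> \<sigma>"
    using P by (auto simp: lattice_pair_def stacked_def)
  have bases: "card (base ` A) = r" "card (base ` B) = s"
    using lattice_pair_base_card[OF P down] by (simp_all add: base_def)
  have supp: "unit i \<in> X" if X: "\<And>x i. x \<in> X \<Longrightarrow> x $ i \<in> \<nat>"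
      "\<And>x k. x \<in> X \<Longrightarrow> x $ k \<ge> 1 \<Longrightarrow> x - unit k \<in> X" and x: "x \<in> X" "x $ i \<noteq> 0"
    for X :: "(real ^ 'n) set" and x i
  proof (rule down_closed_mem[OF X x(1)])
    fix j show "unit i $ j \<in> \<nat>" by (auto simp: axis_def)
    obtain n where n: "x $ j = real n" using X(1)[OF x(1)] Nats_cases by metis
    then show "unit i $ j \<le> x $ j" using x(2) by (cases "j = i") (auto simp: axis_def)
  qed
  have det: "base y = base y'" if "x \<in> A" "x' \<in> A" "y \<in> B" "y' \<in> B" "x + y = x' + y'" for x x' y y'
  proof -
    have "y $ i = y' $ i" if "i \<noteq> z" for i
    proof (cases "unit i \<in> A")
      case True
      then have "unit i \<notin> B" using disj that by blast
      then have "y $ i = 0" "y' $ i = 0"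
        using supp[OF nat(2) down(2)] \<open>y \<in> B\<close> \<open>y' \<in> B\<close> by blast+
      then show ?thesis by simp
    next
      case False
      then have "x $ i = 0" "x' $ i = 0"
        using supp[OF nat(1) down(1)] \<open>x \<in> A\<close> \<open>x' \<in> A\<close> by blast+
      then show ?thesis using \<open>x + y = x' + y'\<close> by (metis vector_add_component add_0)
    qed
    then show ?thesis unfolding base_def by (auto simp: vec_eq_iff axis_def)
  qed
  have eq: "A + B = (\<Union>u\<in>base ` B. A + fibre B u)" by (auto simp: fibre_def set_plus_def)
  have "card (A + B) = (\<Sum>u\<in>base ` B. card (A + fibre B u))"
    unfolding eq
  proof (rule card_UN_disjoint)
    show "\<forall>i\<in>base ` B. \<forall>j\<in>base ` B. i \<noteq> j \<longrightarrow> (A + fibre B i) \<inter> (A + fibre B j) = {}"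
    proof (intro ballI impI equals0I)
      fix i j t assume "i \<noteq> j" "t \<in> (A + fibre B i) \<inter> (A + fibre B j)"
      then obtain x y x' y' where "x \<in> A" "x' \<in> A" "y \<in> B" "y' \<in> B" "x + y = x' + y'" "base y = i" "base y' = j"
        by (auto simp: fibre_def elim!: set_plus_elim)
      then show False using det \<open>i \<noteq> j\<close> by blast
    qed
  qed (use fin in \<open>auto simp: finite_set_plus\<close>)
  also have "\<dots> \<ge> (\<Sum>u\<in>base ` B. card A + r * (card (fibre B u) - 1))"
  proof (rule sum_mono)
    fix u assume "u \<in> base ` B"
    then have "card A + card (base ` A) * (card (fibre B u) - 1) \<le> card (A + fibre B u)"
      using fin by (intro card_plus_lines[of _ _ u]) (auto simp: fibre_def)
    then show "card A + r * (card (fibre B u) - 1) \<le> card (A + fibre B u)" by (simp add: bases)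
  qed
  finally have "real (\<Sum>u\<in>base ` B. card A + r * (card (fibre B u) - 1)) \<le> real \<sigma>"
    using \<sigma> by linarith
  also have "real (\<Sum>u\<in>base ` B. card A + r * (card (fibre B u) - 1))
      = (\<Sum>u\<in>base ` B. real a + real r * (real (card (fibre B u)) - 1))"
    unfolding of_nat_sum
  proof (rule sum.cong)
    fix u assume "u \<in> base ` B"
    then have "fibre B u \<noteq> {}" by (auto simp: fibre_def)
    then have "card (fibre B u) \<ge> 1" using fin by (simp add: Suc_le_eq card_gt_0_iff)
    then show "real (card A + r * (card (fibre B u) - 1)) = real a + real r * (real (card (fibre B u)) - 1)"
      by (simp add: cards of_nat_diff)
  qed simp
  also have "\<dots> = real s * real a + real r * (real (\<Sum>u\<in>base ` B. card (fibre B u)) - real s)"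
    by (simp add: sum.distrib bases sum_subtractf sum_distrib_left right_diff_distrib)
  also have "(\<Sum>u\<in>base ` B. card (fibre B u)) = b"
    using sum.image_gen[OF fin(2), of "\<lambda>_. 1::nat" base] by (simp add: fibre_def cards)
  finally show ?thesis .
qed

section \<open>Adapted coordinates and the main bound\<close>

lemma card_image_same_kernel:
  assumes "\<And>x y. x \<in> A \<Longrightarrow> y \<in> A \<Longrightarrow> f x = f y \<longleftrightarrow> g x = g y"
  shows "card (f ` A) = card (g ` A)"
proof -
  let ?h = "\<lambda>u. g (inv_into A f u)"
  have h: "?h (f x) = g x" if "x \<in> A" for x
    using that assms by (metis f_inv_into_f image_eqI inv_into_into)
  have "inj_on ?h (f ` A)" using h assms by (auto simp: inj_on_def)
  moreover have "?h ` f ` A = g ` A" using h by (auto simp: image_iff)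
  ultimately show ?thesis using card_image by metis
qed

lemma orth_proj_eq_iff:
  assumes "v \<noteq> 0" shows "orth_proj v x = orth_proj v y \<longleftrightarrow> (\<exists>t. x - y = t *\<^sub>R v)"
proof
  assume "orth_proj v x = orth_proj v y"
  then have "x - y = ((v \<bullet> x) / (v \<bullet> v) - (v \<bullet> y) / (v \<bullet> v)) *\<^sub>R v"
    by (simp add: orth_proj_def algebra_simps)
  then show "\<exists>t. x - y = t *\<^sub>R v" by blast
next
  assume "\<exists>t. x - y = t *\<^sub>R v"
  then obtain t where "x = y + t *\<^sub>R v" by (metis add.commute diff_add_cancel)
  then show "orth_proj v x = orth_proj v y"
    using assms by (simp add: orth_proj_def inner_add_right add_divide_distrib algebra_simps)
qed

text \<open>As (x + y) - (a + b) = (x - a) + (y - b), the differences within \<open>A\<close> and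
  within \<open>B\<close> span the space. They extend \<open>v\<close> to a basis, which
  \<open>f\<close> sends to the unit vectors.\<close>

lemma adapted_coordinates:
  fixes A B :: "(real ^ 'n) set"
  assumes dim: "aff_dim (A + B) = int CARD('n)" and v: "v \<noteq> 0"
  obtains f :: "real ^ 'n \<Rightarrow> real ^ 'n" and z where "linear f" "inj f" "f v = unit z"
    "\<And>i. i \<noteq> z \<Longrightarrow> (\<exists>x\<in>f ` A. x + unit i \<in> f ` A) \<or> (\<exists>x\<in>f ` B. x + unit i \<in> f ` B)"
proof -
  define D where "D = (\<lambda>(x, y). x - y) ` (A \<times> A) \<union> (\<lambda>(x, y). x - y) ` (B \<times> B)"
  have "A + B \<noteq> {}" using dim by (auto simp: aff_dim_empty[symmetric])
  then obtain a b where ab: "a \<in> A" "b \<in> B" by (auto simp: set_plus_def)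
  have "(\<lambda>x. x - (a + b)) ` (A + B) \<subseteq> span D"
  proof
    fix u assume "u \<in> (\<lambda>x. x - (a + b)) ` (A + B)"
    then obtain x y where "x \<in> A" "y \<in> B" and u: "u = (x - a) + (y - b)"
      by (auto elim!: set_plus_elim)
    then have "x - a \<in> D" "y - b \<in> D" using ab by (auto simp: D_def)
    then show "u \<in> span D" unfolding u by (intro span_add span_base)
  qed
  then have "dim ((\<lambda>x. x - (a + b)) ` (A + B)) \<le> dim (span D)" by (rule dim_subset)
  moreover have "int (dim ((\<lambda>x. x - (a + b)) ` (A + B))) = int CARD('n)"
    using aff_dim_eq_dim_subtract[of "a + b" "A + B"] ab dim by (simp add: hull_inc set_plus_intro)
  ultimately have "dim D \<ge> CARD('n)" by simp
  then have "dim D = DIM(real ^ 'n)" using dim_subset_UNIV[of D] by simp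
  then have spD: "span D = UNIV" by (simp only: dim_eq_full)
  obtain E where E: "{v} \<subseteq> E" "E \<subseteq> insert v D" "independent E" "insert v D \<subseteq> span E"
    using maximal_independent_subset_extend[of "{v}" "insert v D"] v by auto
  have spE: "span E = UNIV" using spD E(4) by (metis insert_subset span_minimal subspace_span top.extremum_uniqueI)
  then have "card E = CARD('n)"
    using E(3) dim_span_eq_card_independent[of E] by simp
  moreover have finE: "finite E" using E(3) by (rule independent_imp_finite)
  ultimately obtain g where g: "bij_betw g (UNIV :: 'n set) E"
    using finite_same_card_bij[of "UNIV :: 'n set" E] by auto
  obtain f where f: "linear f" "\<And>x. x \<in> E \<Longrightarrow> f x = unit (inv_into UNIV g x)"
    using linear_independent_extend[OF E(3), of "\<lambda>x. unit (inv_into UNIV g x)"] by blast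
  have fg: "f (g i) = unit i" for i
    using g f(2)[of "g i"] by (auto simp: bij_betw_def inv_into_f_f)
  have "Basis \<subseteq> range f"
  proof
    fix u :: "real ^ 'n" assume "u \<in> Basis"
    then obtain i where "u = unit i" by (auto simp: Basis_vec_def)
    then show "u \<in> range f" using fg by (metis rangeI)
  qed
  then have "span Basis \<subseteq> range f"
    using f(1) by (intro span_minimal) (auto intro: linear_subspace_image)
  then have "surj f" by auto
  then have inj: "inj f" using f(1) linear_surjective_imp_injective by blast
  obtain z where z: "g z = v" using g E(1) by (metis bij_betw_imp_surj_on insert_subset imageE)
  show thesis
  proof (rule that[of f z])
    show "f v = unit z" using fg z by blast
    fix i assume "i \<noteq> z"
    then have "g i \<noteq> v" using g z by (metis bij_betw_imp_inj_on inj_eq)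
    moreover have "g i \<in> E" using g by (auto simp: bij_betw_def)
    ultimately have "g i \<in> D" using E(2) by auto
    then consider x y where "x \<in> A" "y \<in> A" "g i = x - y" | x y where "x \<in> B" "y \<in> B" "g i = x - y"
      by (auto simp: D_def)
    then show "(\<exists>x\<in>f ` A. x + unit i \<in> f ` A) \<or> (\<exists>x\<in>f ` B. x + unit i \<in> f ` B)"
    proof cases
      case (1 x y)
      then have "f x - f y = unit i" using fg[of i] f(1) by (simp add: linear_diff)
      then have "f y + unit i = f x" by (metis add.commute diff_add_cancel)
      then show ?thesis using 1 by (metis imageI)
    next
      case (2 x y)
      then have "f x - f y = unit i" using fg[of i] f(1) by (simp add: linear_diff)
      then have "f y + unit i = f x" by (metis add.commute diff_add_cancel)
      then show ?thesis using 2 by (metis imageI)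
    qed
  qed (use f inj in auto)
qed

lemma lattice_reduction:
  fixes A B :: "(real ^ 'n) set"
  assumes fin: "finite A" "finite B" and dim: "aff_dim (A + B) = int CARD('n)" and v: "v \<noteq> 0"
  obtains z :: 'n and A' B' where "lattice_pair z {} (card (A + B)) (card A) (card B)
    (card (orth_proj v ` A)) (card (orth_proj v ` B)) (aff_dim B) A' B'"
proof -
  obtain f :: "real ^ 'n \<Rightarrow> real ^ 'n" and z where f: "linear f" "inj f" "f v = unit z"
    and diff: "\<And>i. i \<noteq> z \<Longrightarrow> (\<exists>x\<in>f ` A. x + unit i \<in> f ` A) \<or> (\<exists>x\<in>f ` B. x + unit i \<in> f ` B)"
    by (rule adapted_coordinates[OF dim v]) blast
  have ne: "A \<noteq> {}" "B \<noteq> {}" using dim by (auto simp: set_plus_def)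
  \<comment> \<open>Both maps have the lines parallel to \<open>v\<close> as fibres, so passing to
    the coordinates of \<open>f\<close>, which need not preserve angles, keeps r_1 and r_2.\<close>
  have ker: "card ((\<lambda>x. x - x $ z *\<^sub>R unit z) ` f ` X) = card (orth_proj v ` X)" for X
    unfolding image_image
  proof (rule card_image_same_kernel)
    fix x y
    show "f x - f x $ z *\<^sub>R unit z = f y - f y $ z *\<^sub>R unit z \<longleftrightarrow> orth_proj v x = orth_proj v y"
    proof
      assume "f x - f x $ z *\<^sub>R unit z = f y - f y $ z *\<^sub>R unit z"
      then have "f (x - y) = f ((f x $ z - f y $ z) *\<^sub>R v)"
        using f by (simp add: linear_diff linear_scale algebra_simps)
      then have "x - y = (f x $ z - f y $ z) *\<^sub>R v" using f(2) by (simp add: inj_eq)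
      then show "orth_proj v x = orth_proj v y" using orth_proj_eq_iff[OF v] by blast
    next
      assume "orth_proj v x = orth_proj v y"
      then obtain t where "x - y = t *\<^sub>R v" using orth_proj_eq_iff[OF v] by blast
      then have "f x = f y + t *\<^sub>R unit z"
        using f by (metis add.commute diff_add_cancel linear_add linear_scale)
      then show "f x - f x $ z *\<^sub>R unit z = f y - f y $ z *\<^sub>R unit z"
        by (simp add: algebra_simps)
    qed
  qed
  have inj: "inj_on f X" for X using f(2) by (rule inj_on_subset) simp
  have "f ` A + f ` B = f ` (A + B)"
  proof (intro equalityI subsetI)
    fix u assume "u \<in> f ` A + f ` B"
    then obtain x y where "x \<in> A" "y \<in> B" "u = f (x + y)"
      by (auto simp: linear_add[OF f(1)] elim!: set_plus_elim)
    then show "u \<in> f ` (A + B)" by blast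
  next
    fix u assume "u \<in> f ` (A + B)"
    then obtain x y where "x \<in> A" "y \<in> B" "u = f x + f y"
      by (auto simp: linear_add[OF f(1)] elim!: set_plus_elim)
    then show "u \<in> f ` A + f ` B" by blast
  qed
  then have sum: "card (f ` A + f ` B) = card (A + B)" by (simp add: card_image inj)
  obtain A' B' where "lattice_pair z {} (card (f ` A + f ` B)) (card (f ` A)) (card (f ` B))
      (card (orth_proj v ` A)) (card (orth_proj v ` B)) (aff_dim (f ` B)) A' B'"
    using axis_compression_to_lattice[OF _ _ _ _ diff ker ker] fin ne by auto
  then have "lattice_pair z {} (card (A + B)) (card A) (card B)
      (card (orth_proj v ` A)) (card (orth_proj v ` B)) (aff_dim B) A' B'"
    using f by (simp add: sum card_image inj)
  then show thesis by (rule that)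
qed

lemma aff_dim_lower:
  fixes B :: "(real ^ 'n) set"
  assumes "0 \<in> B" "unit ` F \<subseteq> B" shows "int (card F) \<le> aff_dim B"
proof -
  have "independent ((unit :: 'n \<Rightarrow> real ^ 'n) ` F)"
    by (rule independent_mono[OF independent_Basis]) (auto simp: axis_in_Basis_iff)
  then have "card ((unit :: 'n \<Rightarrow> real ^ 'n) ` F) \<le> dim B"
    using assms(2) independent_card_le_dim by blast
  moreover have "card ((unit :: 'n \<Rightarrow> real ^ 'n) ` F) = card F"
    by (intro card_image) (auto simp: inj_on_def axis_eq_axis)
  ultimately show ?thesis using assms(1) by (simp add: aff_dim_zero hull_inc)
qed

text \<open>Differences of points of \<open>B\<close> lie in the span of \<open>v\<close> and of r_2
  - 1 differences of projections. This yields c \<le> r_2 and keeps the last denominator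
  positive.\<close>

lemma aff_dim_le_card_orth_proj:
  fixes B :: "(real ^ 'n) set"
  assumes "finite B" "B \<noteq> {}"
  shows "aff_dim B \<le> int (card (orth_proj v ` B))"
proof -
  obtain b where b: "b \<in> B" using assms by blast
  let ?E = "insert v ((\<lambda>u. u - orth_proj v b) ` (orth_proj v ` B - {orth_proj v b}))"
  have "(\<lambda>x. x - b) ` B \<subseteq> span ?E"
  proof
    fix u assume "u \<in> (\<lambda>x. x - b) ` B"
    then obtain x where x: "x \<in> B" "u = x - b" by blast
    have u: "u = (orth_proj v x - orth_proj v b) + ((v \<bullet> x) / (v \<bullet> v) - (v \<bullet> b) / (v \<bullet> v)) *\<^sub>R v"
      by (simp add: x orth_proj_def algebra_simps)
    have "orth_proj v x - orth_proj v b \<in> span ?E"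
      by (cases "orth_proj v x = orth_proj v b") (auto intro!: span_base simp: span_zero x)
    then show "u \<in> span ?E" unfolding u by (intro span_add span_scale) (auto intro: span_base)
  qed
  then have "dim ((\<lambda>x. x - b) ` B) \<le> card ?E" using assms by (intro dim_le_card) auto
  also have "card ?E \<le> Suc (card ((\<lambda>u. u - orth_proj v b) ` (orth_proj v ` B - {orth_proj v b})))"
    using assms by (intro card_insert_le_m1) auto
  also have "\<dots> \<le> Suc (card (orth_proj v ` B - {orth_proj v b}))"
    using assms by (simp add: card_image_le)
  also have "\<dots> = card (orth_proj v ` B)"
    using assms b by (intro card_Suc_Diff1) auto
  finally show ?thesis using aff_dim_eq_dim_subtract[of b B] b by (simp add: hull_inc)
qed

text \<open>\<open>l\<close> and \<open>m\<close> stand for the denominators of the theorem, which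
  bound the numbers of core lines from below.\<close>

lemma comb_coefficient_bound:
  fixes \<alpha> \<beta> \<mu> \<nu> L M l m d e \<sigma> :: real
  assumes S: "\<mu> * \<alpha> + \<nu> * \<beta> - e \<le> \<sigma>" and \<alpha>: "\<alpha> \<ge> \<beta>" "\<beta> \<ge> 0" and \<mu>: "\<mu> \<ge> 1"
    and sum: "\<mu> + \<nu> = (L + M - 1) / L + (L + M - 1) / M + (d - 2)"
    and l: "0 < l" "l \<le> L" and m: "0 < m" "m \<le> M"
  shows "\<alpha> + (d + 1 - 1 / l - 1 / m) * \<beta> - e \<le> \<sigma>"
proof -
  have L: "L > 0" and M: "M > 0" using l m by auto
  have "2 \<le> M / L + L / M" using L M sum_squares_ge_zero[of "L - M" 0]
    by (simp add: field_simps power2_eq_square)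
  moreover have "(L + M - 1) / L + (L + M - 1) / M = 2 + (M / L + L / M) - 1 / L - 1 / M"
    using L M by (simp add: add_divide_distrib diff_divide_distrib)
  moreover have "1 / L \<le> 1 / l" "1 / M \<le> 1 / m" using l m by (auto intro: divide_left_mono)
  ultimately have "d + 1 - 1 / l - 1 / m \<le> \<mu> + \<nu> - 1" using sum by linarith
  then have "(d + 1 - 1 / l - 1 / m) * \<beta> \<le> (\<mu> + \<nu> - 1) * \<beta>" using \<alpha>(2) by (rule mult_right_mono)
  also have "\<dots> = (\<mu> - 1) * \<beta> + \<nu> * \<beta>" by (simp add: algebra_simps)
  also have "\<dots> \<le> (\<mu> - 1) * \<alpha> + \<nu> * \<beta>" using \<alpha> \<mu> by (intro add_right_mono mult_left_mono) auto
  finally show ?thesis using S by (simp add: algebra_simps)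
qed

text \<open>The error term leaves enough room unless r = d and s = 1; there \<open>S\<close> only
  gives \<alpha> + d \<beta> - d, and the fractions must contribute 1.\<close>

lemma disjoint_support_coefficient_bound:
  fixes \<alpha> \<beta> r s d \<sigma> :: nat and \<delta> :: real
  assumes S: "real s * real \<alpha> + real r * (real \<beta> - real s) \<le> \<sigma>"
    and "\<alpha> \<ge> \<beta>" "\<alpha> \<ge> r" "r \<ge> d" "d \<ge> 2" "s \<ge> 1" and \<delta>: "0 \<le> \<delta>" "s = 1 \<Longrightarrow> r = d \<Longrightarrow> \<delta> \<ge> 1"
  shows "real \<alpha> + (real d + 1 - \<delta>) * real \<beta> - (real d - 1) * (real r + real s) \<le> \<sigma>"
proof -
  have le: "(real d + 1 - \<delta>) * \<beta> \<le> (real d + 1) * \<beta>" using \<delta> by (intro mult_right_mono) auto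
  consider "r \<ge> d + 1" | "r = d" "s \<ge> 2" | "r = d" "s = 1" using assms by linarith
  then show ?thesis
  proof cases
    case 1
    have "(real r - (real d + 1)) * \<beta> \<ge> 0" using 1 by simp
    moreover have "(real s - 1) * (real \<alpha> - real r) \<ge> 0" using assms by simp
    moreover have "(real d - 1) * (real r + real s) \<ge> 1 * (real r + real s)"
      using assms by (intro mult_right_mono) auto
    ultimately show ?thesis using S le by (simp add: algebra_simps)
  next
    case 2
    have "(real s - 2) * (real \<alpha> - real r) \<ge> 0" using assms 2 by simp
    moreover have "2 * real d \<le> (real d - 1) * (real r + real s)"
    proof -
      have "(real d - 1) * (real d + 2) \<le> (real d - 1) * (real r + real s)"
        using assms 2 by (intro mult_left_mono) auto
      moreover have "(real d - 2) * (real d + 1) \<ge> 0" using assms by simp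
      ultimately show ?thesis by (simp add: algebra_simps)
    qed
    ultimately show ?thesis using S le assms(2) 2 by (simp add: algebra_simps)
  next
    case 3
    then have "(real d + 1 - \<delta>) * \<beta> \<le> real d * \<beta>" using \<delta> by (intro mult_right_mono) auto
    moreover have "(real d - 1) * (real r + real s) \<ge> 1 * (real r + real s)"
      using assms by (intro mult_right_mono) auto
    ultimately show ?thesis using S 3 by (simp add: algebra_simps)
  qed
qed

theorem theorem1p4:
  fixes A B :: "(real ^ 'n) set" and v :: "real ^ 'n"
    and r\<^sub>1 r\<^sub>2 d :: nat and c :: int
  assumes "d = CARD('n)" and "r\<^sub>1 \<ge> 1" and "r\<^sub>2 \<ge> 1"
    and "r\<^sub>1 \<ge> d" and "d \<ge> 2"
    and "finite A" and "A \<noteq> {}" and "finite B" and "B \<noteq> {}"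
    and "card A \<ge> card B"
    and "aff_dim (A + B) = int d"
    and "v \<noteq> 0"
    and "card (orth_proj v ` A) = r\<^sub>1"
    and "card (orth_proj v ` B) = r\<^sub>2"
    and "c = (if r\<^sub>2 \<ge> d then int d else aff_dim B)"
  shows "real (card (A + B)) \<ge>
    real (card A)
    + (real d + 1 - 1 / (real r\<^sub>1 - real d + 2) - 1 / (real r\<^sub>2 - real_of_int c + 2)) * real (card B)
    - (real d - 1) * (real r\<^sub>1 + real r\<^sub>2)"
proof (cases "r\<^sub>2 < d \<and> card B = r\<^sub>2")
  \<comment> \<open>Every line meets \<open>B\<close> in at most one point, so compression may leave
    \<open>unit z\<close> outside \<open>B\<close>. But |B| = r_2 < d lets the error term absorb (d
    + 1)|B|.\<close>
  case True
  obtain b where "b \<in> B" using assms by blast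
  have "card A = card (A + {b})" by (simp add: card_plus_sing)
  also have "\<dots> \<le> card (A + B)"
    using assms \<open>b \<in> B\<close> by (intro card_mono finite_set_plus set_plus_mono2) auto
  finally have AB: "real (card A) \<le> card (A + B)" by simp
  have "c \<le> int r\<^sub>2 - 1" using True assms aff_dim_le_card[of B] by simp
  then have "real_of_int c \<le> real r\<^sub>2 - 1" by linarith
  then have "1 / (real r\<^sub>2 - real_of_int c + 2) \<ge> 0" "1 / (real r\<^sub>1 - real d + 2) \<ge> 0"
    using assms by simp_all
  then have "real d + 1 - 1 / (real r\<^sub>1 - real d + 2) - 1 / (real r\<^sub>2 - real_of_int c + 2) \<le> real d + 1"
    by linarith
  then have "(real d + 1 - 1 / (real r\<^sub>1 - real d + 2) - 1 / (real r\<^sub>2 - real_of_int c + 2)) * real (card B)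
      \<le> (real d + 1) * real r\<^sub>2" using mult_right_mono[of _ _ "real (card B)"] True by simp
  also have "\<dots> \<le> (real d - 1) * (real r\<^sub>1 + real r\<^sub>2)"
  proof -
    have r: "real r\<^sub>2 + 1 \<le> real d" "real d \<le> real r\<^sub>1" "real r\<^sub>2 \<ge> 1" using True assms by auto
    have "(real d - 2) * (real r\<^sub>2 - 1) \<ge> 0" using assms r by simp
    moreover have "(real d - 1) * (real r\<^sub>2 + 1) \<le> (real d - 1) * real r\<^sub>1"
      using r assms by (intro mult_left_mono) auto
    ultimately show ?thesis using r by (simp add: algebra_simps)
  qed
  finally show ?thesis using AB by linarith
next
  case False
  have B_ge: "card B \<ge> r\<^sub>2" and A_ge: "card A \<ge> r\<^sub>1" using assms card_image_le by metis+
  \<comment> \<open>Some line then carries two points of \<open>B\<close>, which will put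
    \<open>unit z\<close> into the compressed set.\<close>
  have big: "card B > r\<^sub>2" if "r\<^sub>2 < d" using False that B_ge by simp
  have c_le: "c \<le> int r\<^sub>2" using assms aff_dim_le_card_orth_proj[of B v] by auto
  then have c_pos: "real r\<^sub>2 - real_of_int c + 2 > 0" by linarith
  have "aff_dim (A + B) = int CARD('n)" using assms by simp
  then obtain z :: 'n and A0 B0
    where P0: "lattice_pair z {} (card (A + B)) (card A) (card B) r\<^sub>1 r\<^sub>2 (aff_dim B) A0 B0"
    using lattice_reduction[OF \<open>finite A\<close> \<open>finite B\<close> _ \<open>v \<noteq> 0\<close>]
    unfolding \<open>card (orth_proj v ` A) = r\<^sub>1\<close> \<open>card (orth_proj v ` B) = r\<^sub>2\<close> by blast
  show ?thesis
  \<comment> \<open>The alternative ranges over all lattice pairs with these parameters: if it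
    fails, the pair minimised afterwards has no common unit vector besides possibly
    \<open>unit z\<close> either.\<close>
  proof (cases "\<exists>A1 B1 o'. lattice_pair z {} (card (A + B)) (card A) (card B) r\<^sub>1 r\<^sub>2 (aff_dim B) A1 B1
      \<and> o' \<noteq> z \<and> unit o' \<in> A1 \<and> unit o' \<in> B1")
    case True
    then obtain A1 B1 o' where oz: "z \<noteq> o'" and o': "unit o' \<in> A1" "unit o' \<in> B1"
      and "lattice_pair z {} (card (A + B)) (card A) (card B) r\<^sub>1 r\<^sub>2 (aff_dim B) A1 B1"
      by metis
    then have P1: "lattice_pair z {o'} (card (A + B)) (card A) (card B) r\<^sub>1 r\<^sub>2 (aff_dim B) A1 B1"
      by (simp add: lattice_pair_def)
    obtain A' B' L M I J
      where P: "lattice_pair z {o'} (card (A + B)) (card A) (card B) r\<^sub>1 r\<^sub>2 (aff_dim B) A' B'"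
        and cp: "comb_pair z o' A' L I B' M J"
        and down: "\<And>x k. x \<in> A' \<Longrightarrow> x $ k \<ge> 1 \<Longrightarrow> x - unit k \<in> A'"
          "\<And>x k. x \<in> B' \<Longrightarrow> x $ k \<ge> 1 \<Longrightarrow> x - unit k \<in> B'"
      by (rule lattice_pair_to_comb_pair[OF P1 oz]) blast
    interpret comb_pair z o' A' L I B' M J by (rule cp)
    have IJ: "I \<inter> - {z, o'} = I" "J \<inter> - {z, o'} = J" using cover by auto
    have r1: "r\<^sub>1 = L + card I" and r2: "r\<^sub>2 = M + card J"
      using lattice_pair_base_card[OF P down] A.card_base_part[of "- {z, o'}"] B.card_base_part[of "- {z, o'}"]
      by (simp_all add: A.base_def[abs_def] A.part_all B.part_all IJ)
    have ext: "card (- {z, o'}) = d - 2"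
      using oz assms(1) by (simp add: Compl_eq_Diff_UNIV card_Diff_subset)
    have "I \<subseteq> - {z, o'}" "J \<subseteq> - {z, o'}" unfolding cover[symmetric] by simp_all
    then have I_le: "card I \<le> d - 2" and J_le: "card J \<le> d - 2"
      unfolding ext[symmetric] by (simp_all only: card_mono finite)
    \<comment> \<open>Since M = r_2 - |J|, this is the bound M \<ge> r_2 - c + 2. For r_2 < d it
      comes from 0, \<open>unit z\<close>, \<open>unit o'\<close> and the teeth, all in
      \<open>B'\<close>.\<close>
    have J_c: "int (card J) + 2 \<le> c"
    proof (cases "r\<^sub>2 \<ge> d")
      case True
      then show ?thesis using J_le assms by auto
    next
      case False
      have B': "finite B'" "card B' = card B" "card {x \<in> B'. x $ z = 0} = r\<^sub>2" "0 \<in> B'" "unit o' \<in> B'"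
        "aff_dim B' \<le> aff_dim B" and nat: "\<And>x i. x \<in> B' \<Longrightarrow> x $ i \<in> \<nat>"
        using P by (auto simp: lattice_pair_def stacked_def)
      have "{x \<in> B'. x $ z = 0} \<noteq> B'" using B' big False by auto
      then obtain x where x: "x \<in> B'" "x $ z \<noteq> 0" by blast
      have "unit z \<in> B'"
      proof (rule down_closed_mem[OF nat down(2) x(1)])
        fix i show "unit z $ i \<in> \<nat>" by (auto simp: axis_def)
        obtain n where "x $ i = real n" using nat[OF x(1)] Nats_cases by metis
        then show "unit z $ i \<le> x $ i" using x(2) by (cases "i = z") (auto simp: axis_def)
      qed
      then have "int (card (insert z (insert o' J))) \<le> aff_dim B'"
        using B' B.unit_mem by (intro aff_dim_lower) auto
      moreover have "card (insert z (insert o' J)) = card J + 2" using oz B.I by simp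
      ultimately show ?thesis using B' False assms by simp
    qed
    let ?\<mu> = "(real L + real M - 1) / L + card (J - I) + card (I \<inter> J) / 2"
    let ?\<nu> = "(real L + real M - 1) / M + card (I - J) + card (I \<inter> J) / 2"
    have cards: "card A' = card A" "card B' = card B" "card (A' + B') \<le> card (A + B)"
      using P by (auto simp: lattice_pair_def stacked_def)
    show ?thesis
    proof (rule comb_coefficient_bound[of ?\<mu> _ ?\<nu> _ _ _ "real L" "real M"])
      have "?\<mu> * real (card A') + ?\<nu> * real (card B') - (real CARD('n) - 1) * (real (L + card I) + real (M + card J))
          \<le> real (card (A' + B'))" by (rule comb_pair_bound)
      then show "?\<mu> * real (card A) + ?\<nu> * real (card B) - (real d - 1) * (real r\<^sub>1 + real r\<^sub>2) \<le> real (card (A + B))"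
        using cards(3) unfolding cards(1,2) r1[symmetric] r2[symmetric] assms(1)[symmetric] by linarith
      have "(real L + real M - 1) / L \<ge> 1" using A.L B.L by (simp add: field_simps)
      then show "?\<mu> \<ge> 1" by simp
      have "card (J - I) + card (I - J) + card (I \<inter> J) = card (I \<union> J)"
      proof -
        have "card (I \<union> J) = card ((J - I) \<union> (I - J) \<union> (I \<inter> J))" by (rule arg_cong[of _ _ card]) auto
        also have "\<dots> = card ((J - I) \<union> (I - J)) + card (I \<inter> J)" by (rule card_Un_disjoint) auto
        also have "card ((J - I) \<union> (I - J)) = card (J - I) + card (I - J)" by (rule card_Un_disjoint) auto
        finally show ?thesis by simp
      qed
      then have "real (card (J - I)) + real (card (I - J)) + real (card (I \<inter> J)) = real d - 2"
        using ext assms(5) by (simp add: cover)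
      then show "?\<mu> + ?\<nu> = (real L + real M - 1) / real L + (real L + real M - 1) / real M + (real d - 2)"
        by simp
      show "real r\<^sub>1 - real d + 2 \<le> real L" using r1 I_le assms(5) by simp
      show "real r\<^sub>2 - real_of_int c + 2 \<le> real M" using r2 J_c by linarith
    qed (use assms c_pos in auto)
  next
    case False
    \<comment> \<open>Constant weights suffice, as only stability along the axes is used
      below.\<close>
    obtain A' B' where P: "lattice_pair z {} (card (A + B)) (card A) (card B) r\<^sub>1 r\<^sub>2 (aff_dim B) A' B'"
      and st: "squash_stable z {} (\<lambda>_. 1) A' B'"
      by (rule minimal_lattice_pair[OF P0])
    have S: "real r\<^sub>2 * real (card A) + real r\<^sub>1 * (real (card B) - real r\<^sub>2) \<le> real (card (A + B))"
    proof (rule disjoint_support_bound[OF P])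
      show "x - unit k \<in> A'" if "x \<in> A'" "x $ k \<ge> 1" for x k
        using minimal_lattice_pair_down(1)[OF P _ st] that by simp
      show "x - unit k \<in> B'" if "x \<in> B'" "x $ k \<ge> 1" for x k
        using minimal_lattice_pair_down(2)[OF P _ st] that by simp
      show "unit i \<notin> B'" if "i \<noteq> z" "unit i \<in> A'" for i using False P that by blast
    qed
    let ?\<delta> = "1 / (real r\<^sub>1 - real d + 2) + 1 / (real r\<^sub>2 - real_of_int c + 2)"
    \<comment> \<open>|B| > 1 = r_2 forces c = 1, and both fractions equal 1/2.\<close>
    have "?\<delta> \<ge> 1" if "r\<^sub>2 = 1" "r\<^sub>1 = d"
    proof -
      have "c = aff_dim B" "card B > 1" using that assms big by auto
      moreover have "\<exists>x. B = {x}" if "aff_dim B = 0" using that by (simp add: aff_dim_eq_0)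
      moreover have "aff_dim B \<noteq> -1" using assms by (simp add: aff_dim_empty[symmetric])
      moreover have "aff_dim B \<ge> -1" by (rule aff_dim_geq)
      ultimately have "c \<ge> 1" by (cases "aff_dim B = 0") auto
      then have "c = 1" using c_le that by simp
      then show ?thesis using that by simp
    qed
    moreover have "?\<delta> \<ge> 0" using c_pos assms by simp
    ultimately have "real (card A) + (real d + 1 - ?\<delta>) * real (card B) - (real d - 1) * (real r\<^sub>1 + real r\<^sub>2)
        \<le> real (card (A + B))"
      using assms A_ge by (intro disjoint_support_coefficient_bound[OF S]) auto
    then show ?thesis by (simp add: diff_diff_eq)
  qed
qed

end
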